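(* Let $\alpha$ be a probability distribution on $[d]$ with $\alpha_1\ge\cdots\ge\alpha_d$ and $\alpha_1,\dots,\alpha_k>0$, let $n\ge1$, $k\in[d]$, $\lambda\sim\mathrm{SW}^n(\alpha)$, $\underline\lambda=\lambda/n$. Then \[ \mathbb E\Big[\sum_{i=1}^k\alpha_i\Big(\frac{\underline\lambda_i}{\alpha_i}-1\Big)^2\Big]\le\frac{46kd}{n} \quad\text{and}\quad \mathbb E\Big[\sum_{i=1}^k\big(\sqrt{\underline\lambda_i}-\sqrt{\alpha_i}\big)^2\Big]\le\frac{46kd}{n}. \]
   Context: $\mathrm{SW}^n(\alpha)$ is the law of the RSK shape $\mathrm{shRSK}(\boldsymbol w)$ (Young diagram $\lambda_1\ge\cdots\ge\lambda_d\ge0$ whose first $k$ rows sum to the maximum total length of $k$ disjoint weakly increasing subsequences of $\boldsymbol w$), where $\boldsymbol w\in[d]^n$ has i.i.d. letters with law $\alpha$. *)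

theory Defs
  imports Complex_Main
begin

definition weakly_incr_subseq :: "nat list \<Rightarrow> nat set \<Rightarrow> bool" where
  "weakly_incr_subseq w S \<longleftrightarrow> S \<subseteq> {0..<length w} \<and>
     (\<forall>i\<in>S. \<forall>j\<in>S. i < j \<longrightarrow> w ! i \<le> w ! j)"

definition greene :: "nat list \<Rightarrow> nat \<Rightarrow> nat" where
  "greene w k = Max {card (\<Union>i<k. Ss i) | Ss :: nat \<Rightarrow> nat set.
      (\<forall>i<k. weakly_incr_subseq w (Ss i)) \<and>
      (\<forall>i<k. \<forall>j<k. i \<noteq> j \<longrightarrow> Ss i \<inter> Ss j = {})}"

(* RSK shape, 1-indexed rows: lambda_i = greene w i - greene w (i-1) *)
definition shRSK :: "nat list \<Rightarrow> nat \<Rightarrow> nat" where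
  "shRSK w i = greene w i - greene w (i - 1)"

definition words :: "nat \<Rightarrow> nat \<Rightarrow> nat list set" where
  "words d n = {w. length w = n \<and> set w \<subseteq> {1..d}}"

definition word_prob :: "(nat \<Rightarrow> real) \<Rightarrow> nat list \<Rightarrow> real" where
  "word_prob \<alpha> w = (\<Prod>i<length w. \<alpha> (w ! i))"

definition SW_expect :: "nat \<Rightarrow> nat \<Rightarrow> (nat \<Rightarrow> real) \<Rightarrow> ((nat \<Rightarrow> nat) \<Rightarrow> real) \<Rightarrow> real" where
  "SW_expect d n \<alpha> F = (\<Sum>w\<in>words d n. word_prob \<alpha> w * F (shRSK w))"

end

(*
  It suffices to show E (lambda_k - n p)^2 <= 46 d p n for p = alpha_k > 0.

  Choosing the colour classes of an optimal union of increasing subsequences well, one finds that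
  lambda_k is at most the length of an increasing subsequence with letters >= k, and at least the
  number of t with w_t = m(t) for some nonincreasing m with values in {1..k}. Both the maximal
  length and the minimal count evolve like a one-row particle system when letters are appended:
  a pushing system with jump rates alpha_j <= p, and tandem queues with service rates alpha_j >= p.

  An extra particle of rate q (q = p + delta resp. q = p - delta) added at the boundary, together
  with nonnegative initial gaps, can only worsen the bounds, and makes a product of geometric
  distributions stationary. Hence lambda_k is bounded above (below) by a sum of n independent
  geometric variables of mean q plus (minus) the sum of the stationary gaps, whose first two
  moments are explicit; delta = sqrt (d p / n) balances the terms.
*)
theory Submission
  imports Defs "HOL-Probability.Probability"
begin

section \<open>Rows of the shape and monotone paths\<close>

text \<open>Without the shift \<open>delta\<close>, a letter of rate exactly \<open>p\<close> would
  make its gap critical: ratio 1, no stationary law. The shift buys geometric gaps of mean at most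
  \<open>p / delta\<close> at the price of a drift \<open>n * delta\<close>; the total bias
  \<open>n * delta + d * p / delta\<close> is smallest when both terms equal the square root of
  \<open>d * p * n\<close>. The count of the extra particle and the final gaps are dependent. Only
  their marginal laws are computed, and the inequality
  \<open>(a + b + c)^2 <= 3 * (a^2 + b^2 + c^2)\<close> removes any need for covariances. Each
  system bounds \<open>lambda_k\<close> from one side only, so the positive and negative parts of
  \<open>lambda_k - n * p\<close> are treated separately. They contribute
  \<open>24 * d * p * n\<close> and \<open>9 * n * p + 12 * d * p * n\<close>. Where the optimal
  \<open>delta\<close> is unusable, because it is too large or \<open>d * p * n\<close> is too
  small, crude bounds replace the coupling. Dividing the row estimate by
  \<open>n^2 * alpha_i\<close> and summing over rows gives the first claim; the second is dominated
  by it term by term.\<close>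

lemma greene_set_finite:
  "finite {card (\<Union>i<k. Ss i) | Ss :: nat \<Rightarrow> nat set.
      (\<forall>i<k. weakly_incr_subseq w (Ss i)) \<and>
      (\<forall>i<k. \<forall>j<k. i \<noteq> j \<longrightarrow> Ss i \<inter> Ss j = {})}"
proof (rule finite_subset)
  show "{card (\<Union>i<k. Ss i) | Ss :: nat \<Rightarrow> nat set.
      (\<forall>i<k. weakly_incr_subseq w (Ss i)) \<and>
      (\<forall>i<k. \<forall>j<k. i \<noteq> j \<longrightarrow> Ss i \<inter> Ss j = {})} \<subseteq> {..length w}"
  proof clarify
    fix Ss :: "nat \<Rightarrow> nat set"
    assume "\<forall>i<k. weakly_incr_subseq w (Ss i)"
    then have "(\<Union>i<k. Ss i) \<subseteq> {0..<length w}"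
      by (auto simp: weakly_incr_subseq_def)
    from card_mono[OF _ this] show "card (\<Union>i<k. Ss i) \<le> length w" by simp
  qed
qed simp

text \<open>Families of disjoint increasing subsequences are handled from here on as one set with a
  colouring whose classes increase. Colours start at 1 so that they can be compared with letters and
  row indices; the shift to the indices of \<open>greene\<close> happens only here and in the
  converse.\<close>

lemma card_colouring_le_greene:
  assumes S: "S \<subseteq> {..<length w}" and c: "\<And>x. x \<in> S \<Longrightarrow> c x \<in> {1..k}"
    and inc: "\<And>x y. x \<in> S \<Longrightarrow> y \<in> S \<Longrightarrow> x < y \<Longrightarrow> c x = c y \<Longrightarrow> w ! x \<le> w ! y"
  shows "card S \<le> greene w k"
proof -
  let ?Ss = "\<lambda>i. {x \<in> S. c x = Suc i}"
  have eq: "(\<Union>i<k. ?Ss i) = S"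
  proof
    show "S \<subseteq> (\<Union>i<k. ?Ss i)"
    proof
      fix x assume "x \<in> S"
      with c[OF this] show "x \<in> (\<Union>i<k. ?Ss i)"
        by (intro UN_I[of "c x - 1"]) auto
    qed
  qed auto
  have "\<forall>i<k. weakly_incr_subseq w (?Ss i)"
    using S inc by (auto simp: weakly_incr_subseq_def)
  moreover have "\<forall>i<k. \<forall>j<k. i \<noteq> j \<longrightarrow> ?Ss i \<inter> ?Ss j = {}"
    by auto
  ultimately have "card (\<Union>i<k. ?Ss i) \<in> {card (\<Union>i<k. Ss i) | Ss :: nat \<Rightarrow> nat set.
      (\<forall>i<k. weakly_incr_subseq w (Ss i)) \<and>
      (\<forall>i<k. \<forall>j<k. i \<noteq> j \<longrightarrow> Ss i \<inter> Ss j = {})}"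
    by blast
  then show ?thesis
    unfolding eq greene_def by (rule Max_ge[OF greene_set_finite])
qed

lemma greene_colouring:
  obtains S c where "S \<subseteq> {..<length w}" "\<And>x. x \<in> S \<Longrightarrow> c x \<in> {1..k}"
    "\<And>x y. x \<in> S \<Longrightarrow> y \<in> S \<Longrightarrow> x < y \<Longrightarrow> c x = c y \<Longrightarrow> w ! x \<le> w ! y"
    "card S = greene w k"
proof -
  let ?A = "{card (\<Union>i<k. Ss i) | Ss :: nat \<Rightarrow> nat set.
      (\<forall>i<k. weakly_incr_subseq w (Ss i)) \<and>
      (\<forall>i<k. \<forall>j<k. i \<noteq> j \<longrightarrow> Ss i \<inter> Ss j = {})}"
  have "card (\<Union>i<k. (\<lambda>_. {}) i) \<in> ?A"
    by (rule CollectI, rule exI[of _ "\<lambda>_. {}"]) (auto simp: weakly_incr_subseq_def)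
  then have "greene w k \<in> ?A"
    unfolding greene_def by (intro Max_in[OF greene_set_finite]) blast
  then obtain Ss :: "nat \<Rightarrow> nat set" where Ss: "\<And>i. i < k \<Longrightarrow> weakly_incr_subseq w (Ss i)"
    "\<And>i j. i < k \<Longrightarrow> j < k \<Longrightarrow> i \<noteq> j \<Longrightarrow> Ss i \<inter> Ss j = {}" "greene w k = card (\<Union>i<k. Ss i)"
    by blast
  define S where "S = (\<Union>i<k. Ss i)"
  define c where "c x = Suc (THE i. i < k \<and> x \<in> Ss i)" for x
  have c: "c x = Suc i" if "i < k" "x \<in> Ss i" for x i
  proof -
    have "(THE i. i < k \<and> x \<in> Ss i) = i"
      by (rule the_equality) (use that Ss(2) in blast)+
    then show ?thesis by (simp add: c_def)
  qed
  show ?thesis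
  proof (rule that)
    show "S \<subseteq> {..<length w}"
      using Ss(1) by (fastforce simp: S_def weakly_incr_subseq_def)
    show "c x \<in> {1..k}" if "x \<in> S" for x
      using that c by (auto simp: S_def)
    show "w ! x \<le> w ! y" if xy: "x \<in> S" "y \<in> S" "x < y" "c x = c y" for x y
    proof -
      from xy obtain i j where "i < k" "x \<in> Ss i" "j < k" "y \<in> Ss j" by (auto simp: S_def)
      moreover from this xy c have "i = j" by auto
      ultimately show ?thesis using Ss(1)[of i] xy(3) by (auto simp: weakly_incr_subseq_def)
    qed
    show "card S = greene w k" by (simp add: S_def Ss(3))
  qed
qed

section \<open>Recolouring an optimal union by descent ranks\<close>

text \<open>The length of the longest strictly decreasing subsequence of \<open>w\<close> in \<open>S\<close> starting at \<open>x\<close>.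
  If \<open>S\<close> is a union of \<open>k\<close> weakly increasing subsequences, this rank is another colouring of \<open>S\<close>
  with the colours \<open>1..k\<close>, with the extra property that colour \<open>j\<close> only occurs on letters \<open>\<ge> j\<close>.\<close>
function descent_rank :: "nat list \<Rightarrow> nat set \<Rightarrow> nat \<Rightarrow> nat" where
  "descent_rank w S x = Suc (Max (insert 0 (descent_rank w S `
     {y \<in> S. x < y \<and> y < length w \<and> w ! y < w ! x})))"
  by pat_completeness auto
termination by (relation "Wellfounded.measure (\<lambda>(w, S, x). length w - x)") auto

declare descent_rank.simps [simp del]

lemma descent_rank_less:
  assumes "y \<in> S" "x < y" "y < length w" "w ! y < w ! x"
  shows "descent_rank w S y < descent_rank w S x"
  using assms by (subst (2) descent_rank.simps) (auto simp: less_Suc_eq_le intro!: Max_ge)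

lemma descent_rank_pos: "0 < descent_rank w S x"
  by (subst descent_rank.simps) simp

lemma descent_rank_step:
  assumes "1 < descent_rank w S x"
  obtains y where "y \<in> S" "x < y" "y < length w" "w ! y < w ! x"
    "descent_rank w S x = Suc (descent_rank w S y)"
proof -
  let ?R = "descent_rank w S ` {y \<in> S. x < y \<and> y < length w \<and> w ! y < w ! x}"
  have "Max (insert 0 ?R) \<in> insert 0 ?R" by (rule Max_in) auto
  moreover have eq: "descent_rank w S x = Suc (Max (insert 0 ?R))" by (subst descent_rank.simps) simp
  with assms have "Max (insert 0 ?R) \<noteq> 0" by linarith
  ultimately have "Max (insert 0 ?R) \<in> ?R" by blast
  with eq that show ?thesis by auto
qed

text \<open>No colour repeats along a strictly decreasing subsequence, since colour classes increase
  weakly. The set \<open>D\<close> in the proof is such a subsequence of maximal length; recording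
  that \<open>x\<close> is its first position and carries its largest letter lets the next point be
  prepended with \<open>c\<close> still injective.\<close>

lemma descent_rank_le_colours:
  assumes "S \<subseteq> {..<length w}" and c: "\<And>x. x \<in> S \<Longrightarrow> c x \<in> {1..k}"
    and inc: "\<And>x y. x \<in> S \<Longrightarrow> y \<in> S \<Longrightarrow> x < y \<Longrightarrow> c x = c y \<Longrightarrow> w ! x \<le> w ! y"
    and "x \<in> S"
  shows "descent_rank w S x \<le> k"
proof -
  have "\<exists>D \<subseteq> S. card D = descent_rank w S x \<and> x \<in> D \<and> (\<forall>y\<in>D. x \<le> y \<and> w ! y \<le> w ! x) \<and> inj_on c D"
    using \<open>x \<in> S\<close>
  proof (induction "descent_rank w S x" arbitrary: x rule: less_induct)
    case less
    show ?case
    proof (cases "1 < descent_rank w S x")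
      case False
      then have "descent_rank w S x = 1" using descent_rank_pos[of w S x] by linarith
      with less.prems show ?thesis by (intro exI[of _ "{x}"]) auto
    next
      case True
      then obtain y where y: "y \<in> S" "x < y" "y < length w" "w ! y < w ! x"
        "descent_rank w S x = Suc (descent_rank w S y)" by (rule descent_rank_step)
      then obtain D where D: "D \<subseteq> S" "card D = descent_rank w S y" "y \<in> D"
        "\<forall>z\<in>D. y \<le> z \<and> w ! z \<le> w ! y" "inj_on c D"
        using less.hyps[of y] by auto
      have fin: "finite D" using D(2) descent_rank_pos[of w S y] card_ge_0_finite by force
      have x: "x \<notin> D" using D(4) y(2) by auto
      have "c x \<noteq> c z" if "z \<in> D" for z
        using inc[of x z] less.prems that D(1,4) y(2,4) by fastforce
      then have "inj_on c (insert x D)" using D(5) by auto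
      with less.prems D y fin x show ?thesis
        by (intro exI[of _ "insert x D"]) fastforce
    qed
  qed
  then obtain D where D: "D \<subseteq> S" "card D = descent_rank w S x" "inj_on c D" by blast
  then have "card (c ` D) = descent_rank w S x" by (simp add: card_image)
  moreover have "card (c ` D) \<le> card {1..k}" using c D(1) by (intro card_mono) auto
  ultimately show ?thesis by simp
qed

text \<open>Along a longest decreasing subsequence from \<open>x\<close> the rank drops by exactly
  one per step and the letter by at least one. Stopping at rank \<open>i\<close> therefore loses at
  least as much in the letter as in the rank.\<close>

lemma descent_rank_chain:
  assumes "x \<in> S" "1 \<le> i" "i \<le> descent_rank w S x"
  obtains y where "y \<in> S" "x \<le> y" "descent_rank w S y = i" "w ! y + descent_rank w S x \<le> w ! x + i"
proof -
  have "\<exists>y\<in>S. x \<le> y \<and> descent_rank w S y = i \<and> w ! y + descent_rank w S x \<le> w ! x + i"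
    using assms
  proof (induction "descent_rank w S x" arbitrary: x rule: less_induct)
    case less
    show ?case
    proof (cases "i = descent_rank w S x")
      case True
      with less.prems show ?thesis by (intro bexI[of _ x]) auto
    next
      case False
      with less.prems have "1 < descent_rank w S x" by linarith
      then obtain y where y: "y \<in> S" "x < y" "y < length w" "w ! y < w ! x"
        "descent_rank w S x = Suc (descent_rank w S y)" by (rule descent_rank_step)
      with less.prems False have "i \<le> descent_rank w S y" by linarith
      with less.hyps[of y] y less.prems obtain z where
        "z \<in> S" "y \<le> z" "descent_rank w S z = i" "w ! z + descent_rank w S y \<le> w ! y + i"
        by auto
      with y show ?thesis by (intro bexI[of _ z]) auto
    qed
  qed
  with that show ?thesis by blast
qed

lemma descent_rank_le_letter:
  assumes "S \<subseteq> {..<length w}" "0 \<notin> set w" "x \<in> S"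
  shows "descent_rank w S x \<le> w ! x"
proof -
  from descent_rank_pos[of w S x] obtain y where y: "y \<in> S" "w ! y + descent_rank w S x \<le> w ! x + 1"
    using descent_rank_chain[OF assms(3), of 1 w] by (metis One_nat_def Suc_leI order_refl)
  from y assms have "w ! y \<noteq> 0" by (metis lessThan_iff nth_mem subset_iff)
  with y show ?thesis by linarith
qed

lemma descent_rank_incr:
  assumes "S \<subseteq> {..<length w}" "x \<in> S" "y \<in> S" "x < y" "descent_rank w S x = descent_rank w S y"
  shows "w ! x \<le> w ! y"
  using descent_rank_less[of y S x w] assms by force

text \<open>Colour an optimal union for \<open>greene w k\<close> by rank. The classes below
  \<open>k\<close> form a family admissible for \<open>k - 1\<close>, so class \<open>k\<close>
  alone must account for the row length, and rank \<open>k\<close> forces letters at least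
  \<open>k\<close>.\<close>

lemma shRSK_le_incr_subseq:
  assumes "0 \<notin> set w" "1 \<le> k"
  obtains C where "weakly_incr_subseq w C" "\<And>x. x \<in> C \<Longrightarrow> k \<le> w ! x" "shRSK w k \<le> card C"
proof -
  obtain S c where S: "S \<subseteq> {..<length w}" and c: "\<And>x. x \<in> S \<Longrightarrow> c x \<in> {1..k}"
    and inc: "\<And>x y. x \<in> S \<Longrightarrow> y \<in> S \<Longrightarrow> x < y \<Longrightarrow> c x = c y \<Longrightarrow> w ! x \<le> w ! y"
    and card: "card S = greene w k"
    by (rule greene_colouring[of w k]) blast
  let ?r = "descent_rank w S"
  have fin: "finite S" using S finite_subset by blast
  define C where "C = {x \<in> S. ?r x = k}"
  have "card (S - C) \<le> greene w (k - 1)"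
  proof (rule card_colouring_le_greene)
    show "S - C \<subseteq> {..<length w}" using S by auto
    show "?r x \<in> {1..k-1}" if "x \<in> S - C" for x
    proof -
      have "?r x \<le> k" using descent_rank_le_colours[OF S c inc] that by auto
      with descent_rank_pos[of w S x] that show ?thesis by (auto simp: C_def)
    qed
    show "w ! x \<le> w ! y" if "x \<in> S - C" "y \<in> S - C" "x < y" "?r x = ?r y" for x y
      using descent_rank_incr[OF S] that by blast
  qed
  moreover have "card (S - C) = card S - card C" using fin by (intro card_Diff_subset) (auto simp: C_def)
  ultimately have "shRSK w k \<le> card C" using card by (simp add: shRSK_def)
  moreover have "weakly_incr_subseq w C"
    using S descent_rank_incr[OF S] by (auto simp: weakly_incr_subseq_def C_def)
  moreover have "k \<le> w ! x" if "x \<in> C" for x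
    using descent_rank_le_letter[OF S assms(1), of x] that by (auto simp: C_def)
  ultimately show ?thesis using that by blast
qed

lemma shRSK_ge_decr_path:
  assumes "0 \<notin> set w" "1 \<le> k"
  obtains m where "antimono m" "\<And>t. m t \<in> {1..k}" "card {t. t < length w \<and> w ! t = m t} \<le> shRSK w k"
proof -
  obtain S c where S: "S \<subseteq> {..<length w}" and c: "\<And>x. x \<in> S \<Longrightarrow> c x \<in> {1..k-1}"
    and inc: "\<And>x y. x \<in> S \<Longrightarrow> y \<in> S \<Longrightarrow> x < y \<Longrightarrow> c x = c y \<Longrightarrow> w ! x \<le> w ! y"
    and card: "card S = greene w (k - 1)"
    by (rule greene_colouring[of w "k-1"]) blast
  let ?r = "descent_rank w S"
  have fin: "finite S" using S finite_subset by blast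
  have r_le: "?r x \<le> k - 1" if "x \<in> S" for x
    using descent_rank_le_colours[OF S c inc that] .
  \<comment> \<open>Think of the colour classes as \<open>k - 1\<close> disjoint paths rising in time. The lowest level \<open>m t\<close> not
    occupied by a path that has yet to use it is falling in time, and adding all the points on it to
    \<open>S\<close> gives \<open>k\<close> paths: those above \<open>m t\<close> move up by one colour.\<close>
  define Free where "Free t i \<longleftrightarrow> 1 \<le> i \<and> \<not> (\<exists>s\<in>S. t \<le> s \<and> ?r s = i \<and> w ! s = i)" for t i
  define m where "m t = (LEAST i. Free t i)" for t
  have Free_k: "Free t k" for t
    using r_le assms(2) by (force simp: Free_def)
  have Free_m: "Free t (m t)" for t
    unfolding m_def by (rule LeastI, rule Free_k)
  have m_le: "m t \<le> i" if "Free t i" for t i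
    unfolding m_def using that by (rule Least_le)
  have m_range: "m t \<in> {1..k}" for t
    using Free_m[of t] m_le[OF Free_k] by (auto simp: Free_def)
  have anti: "antimono m"
    by (rule antimonoI, rule m_le) (use Free_m in \<open>force simp: Free_def\<close>)
  define M where "M = {t. t < length w \<and> w ! t = m t}"
  \<comment> \<open>Rank never exceeds the letter. If they were equal, descending to rank
    \<open>m t\<close> would reach a point at time at least \<open>t\<close> whose rank and letter
    are both \<open>m t\<close>, although level \<open>m t\<close> is free at time
    \<open>t\<close>.\<close>
  have high: "?r t < w ! t" if t: "t \<in> S" "m t \<le> ?r t" for t
  proof (rule ccontr)
    assume "\<not> ?r t < w ! t"
    then have "w ! t = ?r t"
      using descent_rank_le_letter[OF S assms(1) t(1)] by simp
    then obtain y where y: "y \<in> S" "t \<le> y" "?r y = m t" "w ! y \<le> m t"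
      using descent_rank_chain[OF t(1), of "m t" w] m_range[of t] t(2) by auto
    then have "w ! y = m t" using descent_rank_le_letter[OF S assms(1), of y] by simp
    with y Free_m[of t] show False by (auto simp: Free_def)
  qed
  \<comment> \<open>Minimality of \<open>m t\<close> leaves the level \<open>?r t\<close> occupied
    by some later point of the same rank; rank classes increase, so \<open>w ! t\<close> is at most
    that level.\<close>
  have low: "w ! t = ?r t" if t: "t \<in> S" "?r t < m t" for t
  proof -
    have "\<not> Free t (?r t)" using m_le[of t "?r t"] t by auto
    then obtain s where s: "s \<in> S" "t \<le> s" "?r s = ?r t" "w ! s = ?r t"
      using descent_rank_pos[of w S t] by (auto simp: Free_def)
    have "w ! t \<le> ?r t"
    proof (cases "t = s")
      case False
      then have "t < s" using s(2) by simp
      then show ?thesis using descent_rank_incr[OF S t(1) s(1)] s(3,4) by metis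
    next
      case True
      show ?thesis unfolding True using s(3,4) by (metis order_refl)
    qed
    then show ?thesis using descent_rank_le_letter[OF S assms(1) t(1)] by simp
  qed
  have disj: "S \<inter> M = {}"
  proof (rule ccontr)
    assume "S \<inter> M \<noteq> {}"
    then obtain t where t: "t \<in> S" "w ! t = m t" by (auto simp: M_def)
    show False
      using high[OF t(1)] low[OF t(1)] t descent_rank_le_letter[OF S assms(1) t(1)]
      by linarith
  qed
  define e where "e t = (if t \<in> S then if ?r t < m t then ?r t else Suc (?r t) else m t)" for t
  have e_low: "e t = w ! t \<and> w ! t \<le> m t \<or> t \<in> S \<and> m t \<le> ?r t \<and> e t = Suc (?r t) \<and> e t \<le> w ! t"
    if "t \<in> S \<union> M" for t
    using that high[of t] low[of t] disj by (auto simp: e_def M_def)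
  have "card (S \<union> M) \<le> greene w k"
  proof (rule card_colouring_le_greene)
    show "S \<union> M \<subseteq> {..<length w}" using S by (auto simp: M_def)
    show "e x \<in> {1..k}" if "x \<in> S \<union> M" for x
      using that descent_rank_pos[of w S x] r_le[of x] m_range[of x] assms(2) by (auto simp: e_def)
    \<comment> \<open>Every new colour is at most its letter, with equality for the unshifted ones,
      which settles the case of an unshifted \<open>x\<close>. A shifted \<open>x\<close> cannot
      share its colour with an unshifted later \<open>y\<close>: the first exceeds
      \<open>m x\<close>, the second is at most \<open>m y \<le> m x\<close>.\<close>
    show "w ! x \<le> w ! y" if xy: "x \<in> S \<union> M" "y \<in> S \<union> M" "x < y" "e x = e y" for x y
    proof -
      have "m y \<le> m x" using antimonoD[OF anti] xy(3) by simp
      from e_low[OF xy(1)] show ?thesis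
      proof
        assume "e x = w ! x \<and> w ! x \<le> m x"
        then show ?thesis using e_low[OF xy(2)] xy(4) by (metis order_refl)
      next
        assume x: "x \<in> S \<and> m x \<le> ?r x \<and> e x = Suc (?r x) \<and> e x \<le> w ! x"
        from e_low[OF xy(2)] show ?thesis
        proof
          assume "e y = w ! y \<and> w ! y \<le> m y"
          with x xy(4) \<open>m y \<le> m x\<close> show ?thesis by linarith
        next
          assume y: "y \<in> S \<and> m y \<le> ?r y \<and> e y = Suc (?r y) \<and> e y \<le> w ! y"
          with x xy(4) have "?r x = ?r y" by linarith
          with x y xy(3) show ?thesis by (intro descent_rank_incr[OF S]) blast+
        qed
      qed
    qed
  qed
  moreover have "card (S \<union> M) = card S + card M"
    using fin disj by (intro card_Un_disjoint) (auto simp: M_def)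
  ultimately have "card M \<le> shRSK w k" using card by (simp add: shRSK_def)
  with anti m_range that show ?thesis unfolding M_def by blast
qed

section \<open>Letter chains with a stationary boundary source\<close>

lemma nn_integral_geometric_unfold:
  assumes "0 < p" "p \<le> 1"
  shows "(\<integral>\<^sup>+g. f g \<partial>geometric_pmf p)
       = ennreal p * f 0 + ennreal (1 - p) * (\<integral>\<^sup>+g. f (Suc g) \<partial>geometric_pmf p)"
  using assms by (subst geometric_bind_pmf_unfold) (auto simp: mult.commute)

lemma nn_integral_geometric_id:
  assumes "0 < p" "p \<le> 1"
  shows "(\<integral>\<^sup>+g. of_nat g \<partial>geometric_pmf p) = ennreal ((1 - p) / p)"
proof -
  have "(\<integral>\<^sup>+g. of_nat g \<partial>geometric_pmf p) = (\<integral>\<^sup>+g. ennreal (real g) \<partial>geometric_pmf p)"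
    by (simp add: ennreal_of_nat_eq_real_of_nat)
  also have "\<dots> = ennreal ((1 - p) / p)"
    using expectation_geometric_pmf[of p] integrable_real_geometric_pmf[of p] assms
    by (subst nn_integral_eq_integral) simp_all
  finally show ?thesis .
qed

text \<open>The probabilities of the negative binomial distribution with parameter 3 add up to 1, which
  gives the expectation of \<open>(g + 1) * (g + 2) / 2\<close>.\<close>
lemma nn_integral_geometric_square:
  assumes "0 < p" "p \<le> 1"
  shows "(\<integral>\<^sup>+g. of_nat (g\<^sup>2) \<partial>geometric_pmf p) = ennreal ((1 - p) / p + 2 * ((1 - p) / p)\<^sup>2)"
proof -
  define m where "m = (1 - p) / p"
  have m0: "m \<ge> 0" using assms by (simp add: m_def)
  have "(\<integral>\<^sup>+g. of_nat (g\<^sup>2 + 3 * g + 2) \<partial>geometric_pmf p)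
      = (\<integral>\<^sup>+g. ennreal (2 / p\<^sup>2) * ennreal (pmf (neg_binomial_pmf 3 p) g) \<partial>count_space UNIV)"
    unfolding nn_integral_measure_pmf
  proof (rule nn_integral_cong)
    fix g :: nat
    have "(g + 2) choose g = (g + 2) choose 2"
      by (subst binomial_symmetric) auto
    then have *: "(g + 2) choose g = (g + 2) * (g + 1) div 2"
      by (simp add: choose_two)
    have "2 dvd (g + 2) * (g + 1)" by simp
    then have **: "2 * real ((g + 2) choose g) = (real g + 2) * (real g + 1)"
      unfolding * by (subst real_of_nat_div) (simp_all add: algebra_simps)
    have "pmf (geometric_pmf p) g * (real g ^ 2 + 3 * real g + 2) = 2 / p\<^sup>2 * pmf (neg_binomial_pmf 3 p) g"
    proof -
      have "2 / p\<^sup>2 * pmf (neg_binomial_pmf 3 p) g = 2 * real ((g + 2) choose g) * (p * (1 - p) ^ g)"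
        using assms by (simp add: pmf_neg_binomial field_simps eval_nat_numeral)
      also have "\<dots> = pmf (geometric_pmf p) g * (real g ^ 2 + 3 * real g + 2)"
        unfolding ** using assms by (simp add: algebra_simps power2_eq_square)
      finally show ?thesis ..
    qed
    then have "ennreal (pmf (geometric_pmf p) g) * ennreal (real (g\<^sup>2 + 3 * g + 2))
        = ennreal (2 / p\<^sup>2) * ennreal (pmf (neg_binomial_pmf 3 p) g)"
      by (simp flip: ennreal_mult add: add_ac del: ennreal_plus)
    then show "ennreal (pmf (geometric_pmf p) g) * of_nat (g\<^sup>2 + 3 * g + 2)
        = ennreal (2 / p\<^sup>2) * ennreal (pmf (neg_binomial_pmf 3 p) g)"
      by (simp only: ennreal_of_nat_eq_real_of_nat)
  qed
  also have "\<dots> = ennreal (2 / p\<^sup>2)"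
    by (simp add: nn_integral_cmult nn_integral_pmf)
  also have "2 / p\<^sup>2 = (m + 2 * m\<^sup>2) + (3 * m + 2)"
    using assms by (simp add: m_def field_simps power2_eq_square)
  also have "ennreal \<dots> = ennreal (m + 2 * m\<^sup>2) + ennreal (3 * m + 2)"
    using m0 by (intro ennreal_plus) auto
  also have "(\<integral>\<^sup>+g. of_nat (g\<^sup>2 + 3 * g + 2) \<partial>geometric_pmf p)
      = (\<integral>\<^sup>+g. of_nat (g\<^sup>2) \<partial>geometric_pmf p) + (3 * (\<integral>\<^sup>+g. of_nat g \<partial>geometric_pmf p) + 2)"
    by (simp add: nn_integral_add nn_integral_cmult add.assoc)
  also have "3 * (\<integral>\<^sup>+g. of_nat g \<partial>geometric_pmf p) + 2 = ennreal (3 * m + 2)"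
    using m0 unfolding nn_integral_geometric_id[OF assms] m_def[symmetric]
    by (simp add: ennreal_plus ennreal_mult)
  finally show ?thesis
    unfolding m_def[symmetric] by simp
qed

text \<open>Mean \<open>m\<close> and variance \<open>v\<close>, expressed through nonnegative
  integrals so that no integrability has to be carried along.\<close>

definition square_moments :: "'a pmf \<Rightarrow> ('a \<Rightarrow> nat) \<Rightarrow> real \<Rightarrow> real \<Rightarrow> bool" where
  "square_moments P f m v \<longleftrightarrow> 0 \<le> m \<and> 0 \<le> v \<and> (\<integral>\<^sup>+x. of_nat (f x) \<partial>P) = ennreal m
     \<and> (\<integral>\<^sup>+x. of_nat ((f x)\<^sup>2) \<partial>P) = ennreal (m\<^sup>2 + v)"

lemma square_moments_map: "square_moments (map_pmf g P) f m v \<longleftrightarrow> square_moments P (\<lambda>x. f (g x)) m v"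
  by (simp add: square_moments_def)

lemma square_moments_geometric:
  assumes "0 < p" "p \<le> 1" "m = (1 - p) / p"
  shows "square_moments (geometric_pmf p) (\<lambda>g. g) m (m * (1 + m))"
proof -
  have "0 \<le> m" using assms by simp
  moreover have "m + 2 * m\<^sup>2 = m\<^sup>2 + m * (1 + m)" by (simp add: power2_eq_square algebra_simps)
  ultimately show ?thesis
    using nn_integral_geometric_id[OF assms(1,2)] nn_integral_geometric_square[OF assms(1,2)]
    unfolding square_moments_def assms(3)[symmetric] by (metis add_nonneg_nonneg mult_nonneg_nonneg zero_le_one)
qed

lemma square_moments_pair:
  assumes "square_moments P f m v" "square_moments Q g m' v'"
  shows "square_moments (pair_pmf P Q) (\<lambda>(x, y). f x + g y) (m + m') (v + v')"
proof -
  note a = assms[unfolded square_moments_def]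
  have 1: "(\<integral>\<^sup>+z. of_nat (case z of (x, y) \<Rightarrow> f x + g y) \<partial>pair_pmf P Q) = ennreal (m + m')"
    using a by (simp add: nn_integral_pair_pmf' nn_integral_add ennreal_plus)
  have "(\<integral>\<^sup>+z. of_nat ((case z of (x, y) \<Rightarrow> f x + g y)\<^sup>2) \<partial>pair_pmf P Q)
      = (\<integral>\<^sup>+x. \<integral>\<^sup>+y. of_nat ((f x)\<^sup>2) + 2 * of_nat (f x) * of_nat (g y) + of_nat ((g y)\<^sup>2) \<partial>Q \<partial>P)"
    by (simp add: nn_integral_pair_pmf' power2_sum add_ac)
  also have "\<dots> = (\<integral>\<^sup>+x. of_nat ((f x)\<^sup>2) + of_nat (f x) * (2 * ennreal m') + ennreal (m'\<^sup>2 + v') \<partial>P)"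
    using a by (simp add: nn_integral_add nn_integral_cmult mult.left_commute[of _ 2] mult.assoc del: of_nat_power)
  also have "\<dots> = ennreal (m\<^sup>2 + v) + ennreal m * (2 * ennreal m') + ennreal (m'\<^sup>2 + v')"
    using a by (simp add: nn_integral_add nn_integral_multc del: of_nat_power)
  also have "\<dots> = ennreal ((m\<^sup>2 + v) + m * (2 * m') + (m'\<^sup>2 + v'))"
    using a by (simp add: ennreal_plus ennreal_mult)
  also have "(m\<^sup>2 + v) + m * (2 * m') + (m'\<^sup>2 + v') = (m + m')\<^sup>2 + (v + v')"
    by (simp add: power2_eq_square algebra_simps)
  finally show ?thesis using a 1 by (simp add: square_moments_def)
qed

lemma nn_integral_centered_square:
  assumes "square_moments P f m v"
  shows "(\<integral>\<^sup>+x. ennreal ((real (f x) - m)\<^sup>2) \<partial>P) = ennreal v"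
proof -
  note a = assms[unfolded square_moments_def]
  have "(\<integral>\<^sup>+x. ennreal ((real (f x) - m)\<^sup>2) \<partial>P) + ennreal (2 * m\<^sup>2)
      = (\<integral>\<^sup>+x. ennreal ((real (f x) - m)\<^sup>2) \<partial>P) + ennreal (2 * m) * (\<integral>\<^sup>+x. of_nat (f x) \<partial>P)"
    using a by (simp add: ennreal_mult[symmetric] power2_eq_square)
  also have "\<dots> = (\<integral>\<^sup>+x. ennreal ((real (f x) - m)\<^sup>2) + ennreal (2 * m) * of_nat (f x) \<partial>P)"
    by (simp add: nn_integral_add nn_integral_cmult)
  also have "\<dots> = (\<integral>\<^sup>+x. of_nat ((f x)\<^sup>2) + ennreal (m\<^sup>2) \<partial>P)"
  proof (rule nn_integral_cong)
    fix x
    have "ennreal ((real (f x) - m)\<^sup>2) + ennreal (2 * m) * of_nat (f x)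
        = ennreal ((real (f x) - m)\<^sup>2 + 2 * m * real (f x))"
      using a by (simp add: ennreal_plus ennreal_mult ennreal_of_nat_eq_real_of_nat)
    also have "(real (f x) - m)\<^sup>2 + 2 * m * real (f x) = (real (f x))\<^sup>2 + m\<^sup>2"
      by (simp add: power2_eq_square algebra_simps)
    also have "ennreal \<dots> = of_nat ((f x)\<^sup>2) + ennreal (m\<^sup>2)"
      by (simp add: ennreal_plus ennreal_of_nat_eq_real_of_nat ennreal_power)
    finally show "ennreal ((real (f x) - m)\<^sup>2) + ennreal (2 * m) * of_nat (f x)
        = of_nat ((f x)\<^sup>2) + ennreal (m\<^sup>2)" .
  qed
  also have "\<dots> = ennreal (m\<^sup>2 + v) + ennreal (m\<^sup>2)"
    using a by (simp add: nn_integral_add del: of_nat_power)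
  also have "\<dots> = ennreal v + ennreal (2 * m\<^sup>2)"
    using a by (simp add: ennreal_plus[symmetric] del: ennreal_plus)
  finally show ?thesis by (simp add: add.commute[of _ "ennreal (2 * _)"] ennreal_add_left_cancel)
qed

lemma square_moments_Pi_pmf:
  assumes "finite I" "\<And>i. i \<in> I \<Longrightarrow> square_moments (p i) (\<lambda>y. y) (m i) (v i)"
  shows "square_moments (Pi_pmf I 0 p) (\<lambda>x. \<Sum>i\<in>I. x i) (\<Sum>i\<in>I. m i) (\<Sum>i\<in>I. v i)"
  using assms
proof (induction I rule: finite_induct)
  case empty
  then show ?case by (simp add: square_moments_def)
next
  case (insert i I)
  have eq: "(\<Sum>j\<in>insert i I. (f(i := y)) j) = y + (\<Sum>j\<in>I. f j)" for f :: "'a \<Rightarrow> nat" and y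
    using insert.hyps by (auto simp: intro!: sum.cong)
  have "square_moments (pair_pmf (p i) (Pi_pmf I 0 p)) (\<lambda>(y, f). y + (\<Sum>j\<in>I. f j))
      (m i + (\<Sum>i\<in>I. m i)) (v i + (\<Sum>i\<in>I. v i))"
    by (intro square_moments_pair insert.IH insert.prems) auto
  moreover have "(\<lambda>x. \<Sum>j\<in>insert i I. (case x of (y, f) \<Rightarrow> f(i := y)) j)
      = (\<lambda>(y, f). y + (\<Sum>j\<in>I. f j :: nat))"
    unfolding case_prod_unfold eq ..
  ultimately show ?case
    using insert.hyps by (simp add: Pi_pmf_insert square_moments_map)
qed

section \<open>Stationarity under letters and source events\<close>

lemma nn_integral_geometric_shift:
  assumes "0 \<le> r" "r < 1"
  shows "ennreal r * (\<integral>\<^sup>+y. f (Suc y) \<partial>geometric_pmf (1 - r))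
       = (\<integral>\<^sup>+y. (if 0 < y then f y else 0) \<partial>geometric_pmf (1 - r))"
  using assms by (subst (2) nn_integral_geometric_unfold) auto

text \<open>The weights of \<open>geometric_pmf (1 - r)\<close> have ratio \<open>r\<close>, so
  adding one to a coordinate costs this factor. The balance equations of both particle systems use
  the product law only through this identity.\<close>

lemma nn_integral_geometric_product_shift:
  assumes "finite I" "j \<in> I" "0 \<le> r j" "r j < 1"
  defines "P \<equiv> Pi_pmf I 0 (\<lambda>i. geometric_pmf (1 - r i))"
  shows "ennreal (r j) * (\<integral>\<^sup>+x. f (x(j := Suc (x j))) \<partial>P) = (\<integral>\<^sup>+x. (if 0 < x j then f x else 0) \<partial>P)"
proof -
  define Q where "Q = Pi_pmf (I - {j}) 0 (\<lambda>i. geometric_pmf (1 - r i))"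
  have "P = Pi_pmf (insert j (I - {j})) 0 (\<lambda>i. geometric_pmf (1 - r i))"
    using assms(2) by (simp add: P_def insert_absorb)
  then have P: "P = map_pmf (\<lambda>(x, y). x(j := y)) (pair_pmf Q (geometric_pmf (1 - r j)))"
    using assms(1) by (subst (asm) Pi_pmf_insert)
      (simp_all add: Q_def pair_commute_pmf[of "geometric_pmf _"] pmf.map_comp o_def case_prod_unfold)
  show ?thesis
    unfolding P by (simp add: nn_integral_pair_pmf' nn_integral_geometric_shift[OF assms(3,4),
        of "\<lambda>y. f (_(j := y))"] flip: nn_integral_cmult[where c = "ennreal (r j)" and M = "measure_pmf Q"] cong: if_cong)
qed

text \<open>The balance condition says that \<open>S\<close> is stationary for the continuous-time dynamics in which
  letters have total rate 1 and \<open>Z\<close> has rate \<open>q\<close>. Between two letters there is then a geometric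
  number of \<open>Z\<close>-events; observing the process just before each letter fixes the number of letters.\<close>
lemma geometric_zeros_stationary:
  fixes S :: "'s pmf" and L :: "nat pmf" and q :: real
  assumes q: "0 \<le> q" and bal: "\<And>f. (\<And>x. f x \<le> 1) \<Longrightarrow>
    (\<integral>\<^sup>+x. (\<integral>\<^sup>+j. f (T j x) \<partial>L) \<partial>S) + ennreal q * (\<integral>\<^sup>+x. f (Z x) \<partial>S) = ennreal (1 + q) * (\<integral>\<^sup>+x. f x \<partial>S)"
  shows "bind_pmf S (\<lambda>x. bind_pmf L (\<lambda>j. map_pmf (\<lambda>g. (Z ^^ g) (T j x)) (geometric_pmf (1 / (1 + q))))) = S"
proof (rule pmf_eqI)
  fix y
  define f :: "'s \<Rightarrow> ennreal" where "f = indicator {y}"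
  \<comment> \<open>\<open>R\<close> is the resolvent of \<open>Z\<close> applied to the test
    function; \<open>1 / (1 + q)\<close> is the probability that a letter precedes the next
    \<open>Z\<close>-event. Inserting \<open>R\<close> into the balance equation makes the terms
    \<open>R (Z x)\<close> cancel, which is legitimate because \<open>R \<le> 1\<close> keeps them
    finite.\<close>
  define R where "R x = (\<integral>\<^sup>+g. f ((Z ^^ g) x) \<partial>geometric_pmf (1 / (1 + q)))" for x
  have f1: "f x \<le> 1" for x by (simp add: f_def indicator_def)
  have R1: "R x \<le> 1" for x
  proof -
    have "R x \<le> (\<integral>\<^sup>+g. 1 \<partial>geometric_pmf (1 / (1 + q)))"
      unfolding R_def by (intro nn_integral_mono f1)
    then show ?thesis by simp
  qed
  have q': "0 < 1 / (1 + q)" "1 / (1 + q) \<le> 1" using q by auto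
  have R_step: "ennreal (1 + q) * R x = f x + ennreal q * R (Z x)" for x
  proof -
    have "R x = ennreal (1 / (1 + q)) * f x + ennreal (1 - 1 / (1 + q)) * R (Z x)"
      unfolding R_def by (subst nn_integral_geometric_unfold[OF q']) (simp add: funpow_swap1)
    then have "ennreal (1 + q) * R x = (ennreal (1 + q) * ennreal (1 / (1 + q))) * f x
        + (ennreal (1 + q) * ennreal (1 - 1 / (1 + q))) * R (Z x)"
      by (simp add: distrib_left mult.assoc)
    also have "ennreal (1 + q) * ennreal (1 / (1 + q)) = 1"
      using q by (subst ennreal_mult[symmetric]) auto
    also have "ennreal (1 + q) * ennreal (1 - 1 / (1 + q)) = ennreal q"
      using q by (subst ennreal_mult[symmetric]) (auto simp: field_simps)
    finally show ?thesis by simp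
  qed
  have "(\<integral>\<^sup>+x. (\<integral>\<^sup>+j. R (T j x) \<partial>L) \<partial>S) + ennreal q * (\<integral>\<^sup>+x. R (Z x) \<partial>S) = ennreal (1 + q) * (\<integral>\<^sup>+x. R x \<partial>S)"
    by (rule bal[OF R1])
  also have "\<dots> = (\<integral>\<^sup>+x. f x \<partial>S) + ennreal q * (\<integral>\<^sup>+x. R (Z x) \<partial>S)"
    by (simp add: nn_integral_cmult[symmetric] nn_integral_add[symmetric] R_step)
  finally have eq: "ennreal q * (\<integral>\<^sup>+x. R (Z x) \<partial>S) + (\<integral>\<^sup>+x. (\<integral>\<^sup>+j. R (T j x) \<partial>L) \<partial>S)
      = ennreal q * (\<integral>\<^sup>+x. R (Z x) \<partial>S) + (\<integral>\<^sup>+x. f x \<partial>S)"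
    by (simp add: add.commute)
  have "(\<integral>\<^sup>+x. R (Z x) \<partial>S) \<le> (\<integral>\<^sup>+x. 1 \<partial>S)"
    by (intro nn_integral_mono R1)
  then have "ennreal q * (\<integral>\<^sup>+x. R (Z x) \<partial>S) \<noteq> \<top>"
    by (auto simp: ennreal_mult_eq_top_iff top_unique)
  with eq have "(\<integral>\<^sup>+x. (\<integral>\<^sup>+j. R (T j x) \<partial>L) \<partial>S) = (\<integral>\<^sup>+x. f x \<partial>S)"
    by (simp add: ennreal_add_left_cancel)
  then have "emeasure (bind_pmf S (\<lambda>x. bind_pmf L (\<lambda>j. map_pmf (\<lambda>g. (Z ^^ g) (T j x)) (geometric_pmf (1 / (1 + q)))))) {y}
      = emeasure S {y}"
    by (simp add: R_def f_def flip: nn_integral_indicator del: vimage_eq emeasure_map_pmf)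
  then show "pmf (bind_pmf S (\<lambda>x. bind_pmf L (\<lambda>j. map_pmf (\<lambda>g. (Z ^^ g) (T j x)) (geometric_pmf (1 / (1 + q)))))) y = pmf S y"
    by (simp add: emeasure_pmf_single del: nn_integral_bind_pmf)
qed

section \<open>Coupling of the word, the source count and the state\<close>

primrec word_pmf :: "nat pmf \<Rightarrow> nat \<Rightarrow> nat list pmf" where
  "word_pmf L 0 = return_pmf []"
| "word_pmf L (Suc n) = bind_pmf (word_pmf L n) (\<lambda>w. map_pmf (\<lambda>j. w @ [j]) L)"

text \<open>After each letter a fresh number \<open>g\<close> of source events drawn from
  \<open>G\<close> follows; \<open>h\<close> is the total so far. The three marginals are the word
  law, a sum of independent copies of \<open>G\<close>, and the stationary law when \<open>S\<close>
  is invariant.\<close>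

primrec word_chain :: "nat pmf \<Rightarrow> nat pmf \<Rightarrow> (nat \<Rightarrow> 's \<Rightarrow> 's) \<Rightarrow> ('s \<Rightarrow> 's) \<Rightarrow> 's pmf \<Rightarrow> nat
    \<Rightarrow> (nat list \<times> nat \<times> 's) pmf" where
  "word_chain L G T Z S 0 = map_pmf (\<lambda>x. ([], 0, x)) S"
| "word_chain L G T Z S (Suc n) = bind_pmf (word_chain L G T Z S n) (\<lambda>(w, h, x). bind_pmf L (\<lambda>j.
     map_pmf (\<lambda>g. (w @ [j], h + g, (Z ^^ g) (T j x))) G))"

lemma word_chain_word: "map_pmf fst (word_chain L G T Z S n) = word_pmf L n"
proof (induction n)
  case 0
  then show ?case by (simp add: pmf.map_comp o_def)
next
  case (Suc n)
  show ?case
    by (simp add: Suc[symmetric] map_bind_pmf bind_map_pmf pmf.map_comp o_def case_prod_unfold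
        map_pmf_const map_pmf_def[of "\<lambda>j. _ @ [j]"])
qed

lemma word_chain_state:
  assumes "bind_pmf S (\<lambda>x. bind_pmf L (\<lambda>j. map_pmf (\<lambda>g. (Z ^^ g) (T j x)) G)) = S"
  shows "map_pmf (\<lambda>y. snd (snd y)) (word_chain L G T Z S n) = S"
proof (induction n)
  case 0
  then show ?case by (simp add: pmf.map_comp o_def)
next
  case (Suc n)
  have "map_pmf (\<lambda>y. snd (snd y)) (word_chain L G T Z S (Suc n))
      = bind_pmf (map_pmf (\<lambda>y. snd (snd y)) (word_chain L G T Z S n))
         (\<lambda>x. bind_pmf L (\<lambda>j. map_pmf (\<lambda>g. (Z ^^ g) (T j x)) G))"
    by (simp add: map_bind_pmf bind_map_pmf pmf.map_comp o_def case_prod_unfold)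
  then show ?case using Suc assms by simp
qed

lemma word_chain_count:
  assumes "square_moments G (\<lambda>g. g) m v"
  shows "square_moments (word_chain L G T Z S n) (\<lambda>y. fst (snd y)) (real n * m) (real n * v)"
proof (induction n)
  case 0
  then show ?case by (simp add: square_moments_def)
next
  case (Suc n)
  have "map_pmf (\<lambda>y. fst (snd y)) (word_chain L G T Z S (Suc n))
     = map_pmf (\<lambda>(y, g). fst (snd y) + g) (pair_pmf (word_chain L G T Z S n) G)"
    by (simp add: map_bind_pmf bind_map_pmf pmf.map_comp o_def case_prod_unfold pair_pmf_def bind_return_pmf
        flip: map_pmf_def)
  moreover have "square_moments (map_pmf (\<lambda>(y, g). fst (snd y) + g) (pair_pmf (word_chain L G T Z S n) G))
      (\<lambda>y. y) (real n * m + m) (real n * v + v)"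
    using square_moments_pair[OF Suc assms] by (simp add: square_moments_map case_prod_unfold)
  ultimately show ?case
    using square_moments_map[of "\<lambda>y. fst (snd y)" "word_chain L G T Z S (Suc n)" "\<lambda>y. y"]
    by (simp add: algebra_simps)
qed

lemma word_chain_invariant:
  assumes "\<And>x. x \<in> set_pmf S \<Longrightarrow> P [] 0 x"
    and "\<And>w h x j. P w h x \<Longrightarrow> j \<in> set_pmf L \<Longrightarrow> P (w @ [j]) h (T j x)"
    and "\<And>w h x. P w h x \<Longrightarrow> P w (Suc h) (Z x)"
    and "(w, h, x) \<in> set_pmf (word_chain L G T Z S n)"
  shows "P w h x"
  using assms(4)
proof (induction n arbitrary: w h x)
  case 0
  then show ?case using assms(1) by auto
next
  case (Suc n)
  from Suc.prems obtain v h' x' j g where y: "(v, h', x') \<in> set_pmf (word_chain L G T Z S n)"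
    "j \<in> set_pmf L" "w = v @ [j]" "h = h' + g" "x = (Z ^^ g) (T j x')"
    by auto
  have "P w (h' + i) ((Z ^^ i) (T j x'))" for i
  proof (induction i)
    case 0
    then show ?case using assms(2)[OF Suc.IH[OF y(1)] y(2)] y(3) by simp
  next
    case (Suc i)
    then show ?case using assms(3) by simp
  qed
  then show ?case using y by simp
qed

text \<open>The expectation over words is lifted to the coupled chain, where a deterministic
  invariant \<open>P\<close> ties \<open>F w\<close> to the source count and the state. The number
  of source events per letter has mean \<open>q\<close> and variance \<open>q * (1 + q)\<close>;
  \<open>c\<close> is the deterministic bias left after centring.\<close>

lemma word_pmf_le_stationary:
  fixes F :: "nat list \<Rightarrow> real" and L :: "nat pmf" and S :: "'s pmf"
  assumes q: "0 \<le> q" and bal: "\<And>f. (\<And>x. f x \<le> 1) \<Longrightarrow>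
    (\<integral>\<^sup>+x. (\<integral>\<^sup>+j. f (T j x) \<partial>L) \<partial>S) + ennreal q * (\<integral>\<^sup>+x. f (Z x) \<partial>S) = ennreal (1 + q) * (\<integral>\<^sup>+x. f x \<partial>S)"
    and init: "\<And>x. x \<in> set_pmf S \<Longrightarrow> P [] 0 x"
    and step: "\<And>w h x j. P w h x \<Longrightarrow> j \<in> set_pmf L \<Longrightarrow> P (w @ [j]) h (T j x)"
    and zero: "\<And>w h x. P w h x \<Longrightarrow> P w (Suc h) (Z x)"
    and mom: "square_moments S s m v"
    and F: "\<And>w h x. P w h x \<Longrightarrow> length w = n \<Longrightarrow>
      F w \<le> 3 * ((real h - real n * q)\<^sup>2 + (real (s x) - m)\<^sup>2 + c\<^sup>2)"
  shows "(\<integral>\<^sup>+w. ennreal (F w) \<partial>word_pmf L n) \<le> ennreal (3 * (real n * (q * (1 + q)) + v + c\<^sup>2))"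
proof -
  define G where "G = geometric_pmf (1 / (1 + q))"
  define J where "J = word_chain L G T Z S n"
  have G: "square_moments G (\<lambda>g. g) q (q * (1 + q))"
    unfolding G_def by (rule square_moments_geometric) (use q in \<open>auto simp: field_simps\<close>)
  have v: "0 \<le> v" using mom by (simp add: square_moments_def)
  have len: "length w = n" if "(w, h, x) \<in> set_pmf (word_chain L G T Z S n)" for w h x
    using that by (induction n arbitrary: w h x) auto
  have F': "ennreal (F (fst y)) \<le> 3 * (ennreal ((real (fst (snd y)) - real n * q)\<^sup>2)
      + ennreal ((real (s (snd (snd y))) - m)\<^sup>2) + ennreal (c\<^sup>2))" if y: "y \<in> set_pmf J" for y
  proof -
    obtain w h x where wy: "y = (w, h, x)" by (cases y) auto
    have whx: "(w, h, x) \<in> set_pmf (word_chain L G T Z S n)" using y wy by (simp add: J_def)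
    then have "P w h x" using init step zero by (rule word_chain_invariant[rotated 3])
    then have "F w \<le> 3 * ((real h - real n * q)\<^sup>2 + (real (s x) - m)\<^sup>2 + c\<^sup>2)"
      by (rule F) (rule len[OF whx])
    then have "ennreal (F w) \<le> ennreal (3 * ((real h - real n * q)\<^sup>2 + (real (s x) - m)\<^sup>2 + c\<^sup>2))"
      by (rule ennreal_leI)
    then show ?thesis by (simp add: wy ennreal_mult ennreal_plus)
  qed
  have "(\<integral>\<^sup>+w. ennreal (F w) \<partial>word_pmf L n) = (\<integral>\<^sup>+y. ennreal (F (fst y)) \<partial>J)"
    by (simp add: J_def word_chain_word[of L G T Z S n, symmetric])
  also have "\<dots> \<le> (\<integral>\<^sup>+y. 3 * (ennreal ((real (fst (snd y)) - real n * q)\<^sup>2)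
      + ennreal ((real (s (snd (snd y))) - m)\<^sup>2) + ennreal (c\<^sup>2)) \<partial>J)"
    by (intro nn_integral_mono_AE AE_pmfI F')
  also have "\<dots> = 3 * ((\<integral>\<^sup>+y. ennreal ((real (fst (snd y)) - real n * q)\<^sup>2) \<partial>J)
      + (\<integral>\<^sup>+x. ennreal ((real (s x) - m)\<^sup>2) \<partial>map_pmf (\<lambda>y. snd (snd y)) J) + ennreal (c\<^sup>2))"
    by (simp add: nn_integral_cmult nn_integral_add)
  also have "map_pmf (\<lambda>y. snd (snd y)) J = S"
    unfolding J_def G_def by (rule word_chain_state[OF geometric_zeros_stationary[OF q bal]])
  also have "(\<integral>\<^sup>+y. ennreal ((real (fst (snd y)) - real n * q)\<^sup>2) \<partial>J) = ennreal (real n * (q * (1 + q)))"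
    unfolding J_def by (rule nn_integral_centered_square[OF word_chain_count[OF G]])
  also have "(\<integral>\<^sup>+x. ennreal ((real (s x) - m)\<^sup>2) \<partial>S) = ennreal v"
    by (rule nn_integral_centered_square[OF mom])
  also have "3 * (ennreal (real n * (q * (1 + q))) + ennreal v + ennreal (c\<^sup>2))
      = ennreal (3 * (real n * (q * (1 + q)) + v + c\<^sup>2))"
    using q v by (simp add: ennreal_mult ennreal_plus)
  finally show ?thesis .
qed

section \<open>The pushing system and the tandem queues\<close>

text \<open>\<open>x j\<close> is the difference between the longest weakly increasing subsequences with letters in
  \<open>{k..j}\<close> and in \<open>{k..j - 1}\<close>, that is, the number of letters \<open>j\<close> in the first row of the
  insertion tableau. A letter \<open>j\<close> bumps the next larger letter of the row.\<close>
primrec dec_first :: "nat \<Rightarrow> nat \<Rightarrow> (nat \<Rightarrow> nat) \<Rightarrow> nat \<Rightarrow> nat" where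
  "dec_first 0 i x = x"
| "dec_first (Suc m) i x = (if 0 < x i then x(i := x i - 1) else dec_first m (Suc i) x)"

text \<open>\<open>dec_first m i\<close> searches the \<open>m\<close> sites from \<open>i\<close>
  on, so the fuel \<open>d - j\<close> covers exactly the sites above \<open>j\<close>. The source
  event of this system is \<open>dec_first (Suc d - k) k\<close>, a search through all of
  \<open>{k..d}\<close>.\<close>

definition push :: "nat \<Rightarrow> nat \<Rightarrow> nat \<Rightarrow> (nat \<Rightarrow> nat) \<Rightarrow> nat \<Rightarrow> nat" where
  "push k d j x = (if j \<in> {k..d} then dec_first (d - j) (Suc j) (x(j := Suc (x j))) else x)"

lemma dec_first_below: "i < a \<Longrightarrow> dec_first m a x i = x i"
  by (induction m arbitrary: a) auto

lemma sum_dec_first: "(\<Sum>i=k..j. x i) \<le> Suc (\<Sum>i=k..j. dec_first m a x i)"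
proof (induction m arbitrary: a)
  case (Suc m)
  show ?case
  proof (cases "0 < x a")
    case True
    have "(\<Sum>i=k..j. x i) \<le> (\<Sum>i=k..j. (x(a := x a - 1)) i + (if i = a then 1 else 0))"
      using True by (intro sum_mono) auto
    also have "\<dots> \<le> (\<Sum>i=k..j. (x(a := x a - 1)) i) + 1"
      unfolding sum.distrib by (simp add: sum.delta)
    finally show ?thesis using True by simp
  qed (use Suc in simp)
qed simp

lemma sum_fun_upd_Suc:
  "(\<Sum>i=k..j. (x(l := Suc (x l))) i) = (\<Sum>i=k..j. x i) + (if l \<in> {k..j} then 1 else 0)"
  for x :: "nat \<Rightarrow> nat"
proof -
  have "(\<Sum>i=k..j. (x(l := Suc (x l))) i) = (\<Sum>i=k..j. x i + (if i = l then 1 else 0))"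
    by (intro sum.cong) auto
  also have "\<dots> = (\<Sum>i=k..j. x i) + (if l \<in> {k..j} then 1 else 0)"
    unfolding sum.distrib by (simp add: sum.delta)
  finally show ?thesis .
qed

lemma sum_push_upto:
  assumes "k \<le> l" "l \<le> d"
  shows "(\<Sum>i=k..l. push k d l x i) = Suc (\<Sum>i=k..l. x i)"
proof -
  have "(\<Sum>i=k..l. push k d l x i) = (\<Sum>i=k..l. (x(l := Suc (x l))) i)"
    using assms by (intro sum.cong) (auto simp: push_def dec_first_below)
  also have "\<dots> = Suc (\<Sum>i=k..l. x i)"
    using assms by (simp add: sum_fun_upd_Suc del: fun_upd_apply)
  finally show ?thesis .
qed

text \<open>The site decremented lies to the right of the letter \<open>l\<close>. Partial sums
  reaching \<open>l\<close> gain one before they may lose one, and shorter sums do not see the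
  move.\<close>

lemma sum_push: "(\<Sum>i=k..j. x i) \<le> (\<Sum>i=k..j. push k d l x i)"
proof (cases "l \<in> {k..d}")
  case True
  show ?thesis
  proof (cases "l \<le> j")
    case True
    with \<open>l \<in> {k..d}\<close> have "(\<Sum>i=k..j. x i) + 1 = (\<Sum>i=k..j. (x(l := Suc (x l))) i)"
      by (simp add: sum_fun_upd_Suc del: fun_upd_apply)
    also have "\<dots> \<le> Suc (\<Sum>i=k..j. push k d l x i)"
      using \<open>l \<in> {k..d}\<close> unfolding push_def by (simp add: sum_dec_first del: fun_upd_apply)
    finally show ?thesis by simp
  next
    case False
    then show ?thesis
      by (intro sum_mono) (auto simp: push_def dec_first_below)
  qed
qed (auto simp: push_def)

text \<open>An inequality, unlike an identity, survives source events and arbitrary initial gaps.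
  All upper ends \<open>j\<close> are needed together, because a subsequence ending in a new letter
  \<open>l\<close> reduces to upper end \<open>l\<close>.\<close>

definition incr_bound :: "nat \<Rightarrow> nat \<Rightarrow> nat list \<Rightarrow> nat \<Rightarrow> (nat \<Rightarrow> nat) \<Rightarrow> bool" where
  "incr_bound k d w h x \<longleftrightarrow> (\<forall>C j. weakly_incr_subseq w C \<longrightarrow> (\<forall>t\<in>C. w ! t \<in> {k..j}) \<longrightarrow> j \<le> d
     \<longrightarrow> card C \<le> h + (\<Sum>i=k..j. x i))"

text \<open>If \<open>C\<close> uses the new position, its other letters are at most
  \<open>l\<close>; the old bound with upper end \<open>l\<close> applies to them, and
  \<open>push\<close> raises precisely that partial sum by one.\<close>

lemma incr_bound_push:
  assumes P: "incr_bound k d w h x"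
  shows "incr_bound k d (w @ [l]) h (push k d l x)"
  unfolding incr_bound_def
proof (intro allI impI)
  fix C j
  assume C: "weakly_incr_subseq (w @ [l]) C" and rng: "\<forall>t\<in>C. (w @ [l]) ! t \<in> {k..j}" and j: "j \<le> d"
  let ?n = "length w"
  define C' where "C' = C - {?n}"
  have C'_sub: "C' \<subseteq> {0..<?n}"
    using C by (fastforce simp: C'_def weakly_incr_subseq_def)
  then have nth: "(w @ [l]) ! t = w ! t" if "t \<in> C'" for t
    using that by (auto simp: nth_append)
  have C': "weakly_incr_subseq w C'"
    unfolding weakly_incr_subseq_def
  proof (intro conjI ballI impI C'_sub)
    fix a b assume "a \<in> C'" "b \<in> C'" "a < b"
    then show "w ! a \<le> w ! b"
      using C nth[of a] nth[of b] unfolding weakly_incr_subseq_def C'_def by (metis DiffD1)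
  qed
  show "card C \<le> h + (\<Sum>i=k..j. push k d l x i)"
  proof (cases "?n \<in> C")
    case False
    then have "C = C'" by (simp add: C'_def)
    have "\<forall>t\<in>C'. w ! t \<in> {k..j}"
      using rng nth by (metis \<open>C = C'\<close>)
    with P C' j have "card C' \<le> h + (\<Sum>i=k..j. x i)" unfolding incr_bound_def by blast
    with sum_push[of x k j d l] show ?thesis unfolding \<open>C = C'\<close> by linarith
  next
    case True
    with rng have "(w @ [l]) ! ?n \<in> {k..j}" by blast
    then have l: "k \<le> l" "l \<le> j" by simp_all
    have "\<forall>t\<in>C'. w ! t \<in> {k..l}"
    proof
      fix t assume t: "t \<in> C'"
      then have "t \<in> C" "t < ?n" using C'_sub by (auto simp: C'_def)
      then have "(w @ [l]) ! t \<le> (w @ [l]) ! ?n"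
        using C True unfolding weakly_incr_subseq_def by blast
      moreover have "(w @ [l]) ! t \<in> {k..j}" using rng \<open>t \<in> C\<close> by blast
      ultimately show "w ! t \<in> {k..l}" using nth[OF t] by simp
    qed
    then have "card C' \<le> h + (\<Sum>i=k..l. x i)"
      using P C' le_trans[OF l(2) j] unfolding incr_bound_def by blast
    also have "Suc \<dots> = h + (\<Sum>i=k..l. push k d l x i)"
      using sum_push_upto[of k l d x] l j by simp
    also have "\<dots> \<le> h + (\<Sum>i=k..j. push k d l x i)"
      using l by (intro add_left_mono sum_mono2) auto
    finally have "Suc (card C') \<le> h + (\<Sum>i=k..j. push k d l x i)" by simp
    moreover have "card C = Suc (card C')"
      using True C'_sub finite_subset[OF C'_sub] unfolding C'_def
      by (metis card.remove finite_Diff_insert finite_Diff2 finite.emptyI finite_atLeastLessThan finite_insert)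
    ultimately show ?thesis by simp
  qed
qed

lemma incr_bound_zero:
  "incr_bound k d w h x \<Longrightarrow> incr_bound k d w (Suc h) (dec_first m a x)"
  unfolding incr_bound_def
proof (intro allI impI)
  fix C j
  assume "\<forall>C j. weakly_incr_subseq w C \<longrightarrow> (\<forall>t\<in>C. w ! t \<in> {k..j}) \<longrightarrow> j \<le> d \<longrightarrow> card C \<le> h + (\<Sum>i=k..j. x i)"
    and "weakly_incr_subseq w C" "\<forall>t\<in>C. w ! t \<in> {k..j}" "j \<le> d"
  then have "card C \<le> h + (\<Sum>i=k..j. x i)" by blast
  with sum_dec_first[of x k j m a] show "card C \<le> Suc h + (\<Sum>i=k..j. dec_first m a x i)"
    by linarith
qed

lemma incr_bound_init: "incr_bound k d [] 0 x"
  by (auto simp: incr_bound_def weakly_incr_subseq_def)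

lemma shRSK_le_incr_bound:
  assumes "incr_bound k d w h x" "set w \<subseteq> {1..d}" "1 \<le> k"
  shows "shRSK w k \<le> h + (\<Sum>i=k..d. x i)"
proof -
  have "0 \<notin> set w" using assms(2) by auto
  then obtain C where C: "weakly_incr_subseq w C" "\<And>t. t \<in> C \<Longrightarrow> k \<le> w ! t" "shRSK w k \<le> card C"
    using shRSK_le_incr_subseq[OF _ assms(3)] by metis
  have "w ! t \<in> {k..d}" if "t \<in> C" for t
  proof -
    have "t < length w" using C(1) that by (auto simp: weakly_incr_subseq_def)
    then have "w ! t \<in> {1..d}" using assms(2) nth_mem by blast
    with C(2)[OF that] show ?thesis by simp
  qed
  then have "card C \<le> h + (\<Sum>i=k..d. x i)" using assms(1) C(1) by (simp add: incr_bound_def)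
  with C(3) show ?thesis by simp
qed

section \<open>Tandem queues and nonincreasing paths\<close>

text \<open>Here \<open>x j\<close> is the length of the queue at server \<open>j\<close> of a series of servers \<open>k, ..., 1\<close>;
  \<open>incr_at 0\<close> discards the customers who leave the last server. Partial sums of the queues
  compare the minimal counts along nonincreasing paths with the number of arrivals.\<close>
primrec incr_at :: "nat \<Rightarrow> (nat \<Rightarrow> nat) \<Rightarrow> nat \<Rightarrow> nat" where
  "incr_at 0 x = x"
| "incr_at (Suc j) x = x(Suc j := Suc (x (Suc j)))"

definition serve :: "nat \<Rightarrow> nat \<Rightarrow> (nat \<Rightarrow> nat) \<Rightarrow> nat \<Rightarrow> nat" where
  "serve k j x = (if j \<in> {1..k} \<and> 0 < x j then incr_at (j - 1) (x(j := x j - 1)) else x)"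

text \<open>In the queue dynamics, \<open>h\<close> minus the queues from \<open>j\<close> to
  \<open>k\<close> equals the departures from server \<open>j\<close> less the customers initially
  at servers \<open>j\<close> to \<open>k\<close>. The invariant bounds this by the hits on any
  nonincreasing path that stays at or above \<open>j\<close>.\<close>

definition decr_bound :: "nat \<Rightarrow> nat list \<Rightarrow> nat \<Rightarrow> (nat \<Rightarrow> nat) \<Rightarrow> bool" where
  "decr_bound k w h x \<longleftrightarrow> (\<forall>m j. antimono m \<longrightarrow> (\<forall>t. m t \<in> {1..k}) \<longrightarrow> j \<in> {1..k} \<longrightarrow>
     (\<forall>t<length w. j \<le> m t) \<longrightarrow> h \<le> card {t. t < length w \<and> w ! t = m t} + (\<Sum>i=j..k. x i))"

lemma incr_at_ge: "x i \<le> incr_at j x i"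
  by (cases j) auto

lemma serve_other: "i \<noteq> l \<Longrightarrow> x i \<le> serve k l x i"
  using incr_at_ge[of "x(l := x l - 1)" i "l - 1"] by (auto simp: serve_def)

text \<open>A service at \<open>l > j\<close> moves its customer to \<open>l - 1 \<ge> j\<close>,
  inside the range, and a service at \<open>l < j\<close> happens outside it. Only server
  \<open>j\<close> itself can lower the sum from \<open>j\<close> on.\<close>

lemma sum_serve_ge:
  assumes "j \<noteq> l" "1 \<le> j"
  shows "(\<Sum>i=j..k. x i) \<le> (\<Sum>i=j..k. serve k l x i)"
proof (cases "l \<in> {j..k} \<and> 0 < x l")
  case False
  then show ?thesis
    by (intro sum_mono) (metis atLeastAtMost_iff serve_def serve_other order_refl)
next
  case True
  with assms have l: "j < l" "l \<le> k" "0 < x l" by auto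
  then obtain a where a: "l = Suc a" by (cases l) auto
  define y where "y = x(l := x l - 1)"
  have "(\<Sum>i=j..k. x i) = (\<Sum>i=j..k. (y(l := Suc (y l))) i)"
    using l by (intro sum.cong) (auto simp: y_def)
  also have "\<dots> = Suc (\<Sum>i=j..k. y i)"
    using l by (simp add: sum_fun_upd_Suc del: fun_upd_apply)
  also have "\<dots> \<le> (\<Sum>i=j..k. serve k l x i)"
  proof -
    obtain b where "a = Suc b" using l a assms(2) by (cases a) auto
    then have "serve k l x = y(a := Suc (y a))"
      using l a by (auto simp: serve_def y_def)
    with l a show ?thesis
      by (simp add: sum_fun_upd_Suc del: fun_upd_apply)
  qed
  finally show ?thesis .
qed

lemma sum_serve_ge_pred: "(\<Sum>i=l..k. x i) \<le> Suc (\<Sum>i=l..k. serve k l x i)"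
proof (cases "l \<le> k")
  case True
  have "(\<Sum>i=Suc l..k. x i) \<le> (\<Sum>i=Suc l..k. serve k l x i)"
    by (intro sum_mono serve_other) auto
  moreover have "x l \<le> Suc (serve k l x l)"
    using incr_at_ge[of "x(l := x l - 1)" l "l - 1"] by (auto simp: serve_def)
  ultimately show ?thesis
    using True by (simp add: sum.atLeast_Suc_atMost)
qed simp

text \<open>Only \<open>j = l\<close> is critical. If the path is at \<open>l\<close> now, the new
  hit pays for the departure. Otherwise it is above \<open>l\<close>, hence was at least
  \<open>m ?n\<close> throughout, and the old bound with lower end \<open>m ?n\<close> involves
  queues that server \<open>l\<close> cannot lower.\<close>

lemma decr_bound_serve:
  assumes P: "decr_bound k w h x"
  shows "decr_bound k (w @ [l]) h (serve k l x)"
  unfolding decr_bound_def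
proof (intro allI impI)
  fix m :: "nat \<Rightarrow> nat" and j
  assume m: "antimono m" "\<forall>t. m t \<in> {1..k}" and j: "j \<in> {1..k}"
    and ge: "\<forall>t<length (w @ [l]). j \<le> m t"
  let ?n = "length w"
  define M where "M = {t. t < ?n \<and> w ! t = m t}"
  define M' where "M' = {t. t < length (w @ [l]) \<and> (w @ [l]) ! t = m t}"
  have M': "M' = (if l = m ?n then insert ?n M else M)"
    by (auto simp: M_def M'_def nth_append less_Suc_eq)
  have cM: "card M' = card M + (if l = m ?n then 1 else 0)"
    unfolding M' by (simp add: M_def)
  have P': "h \<le> card M + (\<Sum>i=a..k. x i)" if "a \<in> {1..k}" "\<forall>t<?n. a \<le> m t" for a
    using P m that unfolding decr_bound_def M_def by blast
  have "h \<le> card M' + (\<Sum>i=j..k. serve k l x i)"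
  proof (cases "j = l")
    case False
    then have "(\<Sum>i=j..k. x i) \<le> (\<Sum>i=j..k. serve k l x i)"
      using j by (intro sum_serve_ge) auto
    moreover have "h \<le> card M + (\<Sum>i=j..k. x i)" using P' j ge by simp
    ultimately show ?thesis using cM by linarith
  next
    case jl: True
    show ?thesis
    proof (cases "l = m ?n")
      case True
      have "h \<le> card M + (\<Sum>i=j..k. x i)" using P' j ge by simp
      with sum_serve_ge_pred[where l = j and k = k and x = x] cM True jl show ?thesis by simp
    next
      case False
      then have lt: "l < m ?n" using ge jl by (simp add: le_neq_implies_less)
      have "h \<le> card M + (\<Sum>i=m ?n..k. x i)"
        using P'[of "m ?n"] m antimonoD[OF m(1)] by simp
      moreover have "(\<Sum>i=m ?n..k. x i) \<le> (\<Sum>i=m ?n..k. serve k l x i)"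
        using lt m(2) by (intro sum_serve_ge) auto
      moreover have "\<dots> \<le> (\<Sum>i=j..k. serve k l x i)"
        using lt jl by (intro sum_mono2) auto
      ultimately show ?thesis using cM by linarith
    qed
  qed
  then show "h \<le> card {t. t < length (w @ [l]) \<and> (w @ [l]) ! t = m t} + (\<Sum>i=j..k. serve k l x i)"
    unfolding M'_def .
qed

lemma decr_bound_zero: "decr_bound k w h x \<Longrightarrow> decr_bound k w (Suc h) (incr_at k x)"
proof (cases k)
  case (Suc a)
  assume P: "decr_bound k w h x"
  have *: "(\<Sum>i=j..k. incr_at k x i) = Suc (\<Sum>i=j..k. x i)" if "j \<in> {1..k}" for j
  proof -
    have "incr_at k x = x(k := Suc (x k))" using Suc by (simp only: incr_at.simps)
    with that show ?thesis by (simp add: sum_fun_upd_Suc del: fun_upd_apply)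
  qed
  show ?thesis
    using P unfolding decr_bound_def by (simp add: *)
qed (simp add: decr_bound_def)

lemma decr_bound_init: "decr_bound k [] 0 x"
  by (auto simp: decr_bound_def)

lemma shRSK_ge_decr_bound:
  assumes "decr_bound k w h x" "set w \<subseteq> {1..d}" "1 \<le> k"
  shows "h \<le> shRSK w k + (\<Sum>i=1..k. x i)"
proof -
  have "0 \<notin> set w" using assms(2) by auto
  then obtain m where m: "antimono m" "\<And>t. m t \<in> {1..k}"
    "card {t. t < length w \<and> w ! t = m t} \<le> shRSK w k"
    using shRSK_ge_decr_path[OF _ assms(3)] by metis
  have "h \<le> card {t. t < length w \<and> w ! t = m t} + (\<Sum>i=1..k. x i)"
  proof (rule assms(1)[unfolded decr_bound_def, rule_format])
    show "1 \<in> {1..k}" using assms(3) by simp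
    show "1 \<le> m t" for t using m(2)[of t] by simp
  qed (fact m)+
  with m(3) show ?thesis by simp
qed

section \<open>Balance equations of the two systems\<close>

text \<open>A site-by-site form of Burke's theorem: under \<open>P\<close>, letters \<open>i\<close>
  together with source events entering at \<open>i\<close> act on average like a source of rate
  \<open>q\<close> entering at \<open>Suc i\<close>. The induction starts from the empty range at
  \<open>Suc d\<close>; \<open>i + m = Suc d\<close> keeps the search ending at
  \<open>d\<close>.\<close>

lemma push_balance_upto:
  fixes \<alpha> :: "nat \<Rightarrow> real"
  assumes \<alpha>: "\<And>j. j \<in> {k..d} \<Longrightarrow> 0 \<le> \<alpha> j \<and> \<alpha> j < q" and "k \<le> i" "i + m = Suc d"
  defines "P \<equiv> Pi_pmf {k..d} 0 (\<lambda>j. geometric_pmf (1 - \<alpha> j / q))"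
  shows "(\<Sum>j=i..d. ennreal (\<alpha> j) * (\<integral>\<^sup>+x. f (push k d j x) \<partial>P))
      + ennreal q * (\<integral>\<^sup>+x. f (dec_first m i x) \<partial>P)
    = (ennreal q + (\<Sum>j=i..d. ennreal (\<alpha> j))) * (\<integral>\<^sup>+x. f x \<partial>P)"
  using assms(2,3)
proof (induction m arbitrary: i)
  case 0
  then show ?case by simp
next
  case (Suc m)
  then have i: "i \<in> {k..d}" and m: "m = d - i" by auto
  have q: "0 < q" "0 \<le> \<alpha> i" "\<alpha> i < q" using \<alpha>[OF i] by auto
  have shift: "ennreal (\<alpha> i) * (\<integral>\<^sup>+x. g (x(i := Suc (x i))) \<partial>P) = ennreal q * (\<integral>\<^sup>+x. (if 0 < x i then g x else 0) \<partial>P)" for g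
  proof -
    have "ennreal (\<alpha> i) = ennreal q * ennreal (\<alpha> i / q)"
      using q by (subst ennreal_mult[symmetric]) auto
    then show ?thesis
      unfolding P_def using nn_integral_geometric_product_shift[of "{k..d}" i "\<lambda>j. \<alpha> j / q" g] i q
      by (simp add: mult.assoc)
  qed
  have 1: "ennreal (\<alpha> i) * (\<integral>\<^sup>+x. f (push k d i x) \<partial>P)
      = ennreal q * (\<integral>\<^sup>+x. (if 0 < x i then f (dec_first m (Suc i) x) else 0) \<partial>P)"
    using shift[of "\<lambda>x. f (dec_first m (Suc i) x)"] i by (simp add: push_def m)
  have 2: "ennreal (\<alpha> i) * (\<integral>\<^sup>+x. f x \<partial>P) = ennreal q * (\<integral>\<^sup>+x. (if 0 < x i then f (x(i := x i - 1)) else 0) \<partial>P)"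
    using shift[of "\<lambda>x. f (x(i := x i - 1))"] by simp
  \<comment> \<open>This holds pointwise: for \<open>x i = 0\<close> both sides reduce to
    \<open>f (dec_first m (Suc i) x)\<close>, otherwise they contain the same two terms.\<close>
  have "(\<integral>\<^sup>+x. (if 0 < x i then f (dec_first m (Suc i) x) else 0) \<partial>P) + (\<integral>\<^sup>+x. f (dec_first (Suc m) i x) \<partial>P)
      = (\<integral>\<^sup>+x. (if 0 < x i then f (x(i := x i - 1)) else 0) \<partial>P) + (\<integral>\<^sup>+x. f (dec_first m (Suc i) x) \<partial>P)"
    by (subst (1 2) nn_integral_add[symmetric]) (auto intro!: nn_integral_cong simp: add.commute)
  then have 3: "ennreal (\<alpha> i) * (\<integral>\<^sup>+x. f (push k d i x) \<partial>P) + ennreal q * (\<integral>\<^sup>+x. f (dec_first (Suc m) i x) \<partial>P)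
      = ennreal (\<alpha> i) * (\<integral>\<^sup>+x. f x \<partial>P) + ennreal q * (\<integral>\<^sup>+x. f (dec_first m (Suc i) x) \<partial>P)"
    unfolding 1 2 by (simp flip: distrib_left)
  have split: "(\<Sum>j=i..d. g j) = g i + (\<Sum>j=Suc i..d. g j)" for g :: "nat \<Rightarrow> ennreal"
    using i by (simp add: sum.atLeast_Suc_atMost)
  have IH: "(\<Sum>j=Suc i..d. ennreal (\<alpha> j) * (\<integral>\<^sup>+x. f (push k d j x) \<partial>P))
      + ennreal q * (\<integral>\<^sup>+x. f (dec_first m (Suc i) x) \<partial>P)
    = (ennreal q + (\<Sum>j=Suc i..d. ennreal (\<alpha> j))) * (\<integral>\<^sup>+x. f x \<partial>P)"
    by (rule Suc.IH) (use Suc.prems in auto)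
  have "(\<Sum>j=i..d. ennreal (\<alpha> j) * (\<integral>\<^sup>+x. f (push k d j x) \<partial>P)) + ennreal q * (\<integral>\<^sup>+x. f (dec_first (Suc m) i x) \<partial>P)
      = (ennreal (\<alpha> i) * (\<integral>\<^sup>+x. f (push k d i x) \<partial>P) + ennreal q * (\<integral>\<^sup>+x. f (dec_first (Suc m) i x) \<partial>P))
        + (\<Sum>j=Suc i..d. ennreal (\<alpha> j) * (\<integral>\<^sup>+x. f (push k d j x) \<partial>P))"
    unfolding split by (simp only: add_ac)
  also have "\<dots> = ennreal (\<alpha> i) * (\<integral>\<^sup>+x. f x \<partial>P) + ((\<Sum>j=Suc i..d. ennreal (\<alpha> j) * (\<integral>\<^sup>+x. f (push k d j x) \<partial>P))
      + ennreal q * (\<integral>\<^sup>+x. f (dec_first m (Suc i) x) \<partial>P))"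
    unfolding 3 by (simp only: add_ac)
  also have "\<dots> = (ennreal q + (\<Sum>j=i..d. ennreal (\<alpha> j))) * (\<integral>\<^sup>+x. f x \<partial>P)"
    unfolding IH split by (simp add: distrib_right add_ac)
  finally show ?case .
qed

text \<open>Burke's theorem for a queue with ratio \<open>q / \<alpha> j\<close>: its departures
  feed the next server like arrivals of rate \<open>q\<close>. The induction runs from the exit,
  where \<open>incr_at 0\<close> does nothing, up to server \<open>i\<close>.\<close>

lemma serve_balance_upto:
  fixes \<alpha> :: "nat \<Rightarrow> real"
  assumes q: "0 < q" and \<alpha>: "\<And>j. j \<in> {1..k} \<Longrightarrow> q < \<alpha> j" and "i \<le> k"
  defines "P \<equiv> Pi_pmf {1..k} 0 (\<lambda>j. geometric_pmf (1 - q / \<alpha> j))"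
  shows "(\<Sum>j=1..i. ennreal (\<alpha> j) * (\<integral>\<^sup>+x. f (serve k j x) \<partial>P))
      + ennreal q * (\<integral>\<^sup>+x. f (incr_at i x) \<partial>P)
    = (ennreal q + (\<Sum>j=1..i. ennreal (\<alpha> j))) * (\<integral>\<^sup>+x. f x \<partial>P)"
  using assms(3)
proof (induction i)
  case 0
  then show ?case by simp
next
  case (Suc i)
  let ?j = "Suc i"
  from Suc.prems have j: "?j \<in> {1..k}" by simp
  have a: "q < \<alpha> ?j" using \<alpha>[OF j] .
  have shift: "ennreal q * (\<integral>\<^sup>+x. g (x(?j := Suc (x ?j))) \<partial>P)
      = ennreal (\<alpha> ?j) * (\<integral>\<^sup>+x. (if 0 < x ?j then g x else 0) \<partial>P)" for g
  proof -
    have "ennreal q = ennreal (\<alpha> ?j) * ennreal (q / \<alpha> ?j)"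
      using q a by (subst ennreal_mult[symmetric]) auto
    then show ?thesis
      unfolding P_def using nn_integral_geometric_product_shift[of "{1..k}" ?j "\<lambda>j. q / \<alpha> j" g] j q a
      by (simp add: mult.assoc)
  qed
  have 1: "ennreal q * (\<integral>\<^sup>+x. f (incr_at ?j x) \<partial>P) = ennreal (\<alpha> ?j) * (\<integral>\<^sup>+x. (if 0 < x ?j then f x else 0) \<partial>P)"
    using shift[of f] by simp
  have 2: "ennreal q * (\<integral>\<^sup>+x. f (incr_at i x) \<partial>P)
      = ennreal (\<alpha> ?j) * (\<integral>\<^sup>+x. (if 0 < x ?j then f (incr_at i (x(?j := x ?j - 1))) else 0) \<partial>P)"
    using shift[of "\<lambda>x. f (incr_at i (x(?j := x ?j - 1)))"] by simp
  have "(\<integral>\<^sup>+x. f (serve k ?j x) \<partial>P) + (\<integral>\<^sup>+x. (if 0 < x ?j then f x else 0) \<partial>P)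
      = (\<integral>\<^sup>+x. f x \<partial>P) + (\<integral>\<^sup>+x. (if 0 < x ?j then f (incr_at i (x(?j := x ?j - 1))) else 0) \<partial>P)"
    using j by (subst (1 2) nn_integral_add[symmetric])
      (auto intro!: nn_integral_cong simp: serve_def add.commute)
  then have 3: "ennreal (\<alpha> ?j) * (\<integral>\<^sup>+x. f (serve k ?j x) \<partial>P) + ennreal q * (\<integral>\<^sup>+x. f (incr_at ?j x) \<partial>P)
      = ennreal (\<alpha> ?j) * (\<integral>\<^sup>+x. f x \<partial>P) + ennreal q * (\<integral>\<^sup>+x. f (incr_at i x) \<partial>P)"
    unfolding 1 2 by (simp flip: distrib_left)
  have split: "(\<Sum>j=1..?j. g j) = (\<Sum>j=1..i. g j) + g ?j" for g :: "nat \<Rightarrow> ennreal"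
    by simp
  have IH: "(\<Sum>j=1..i. ennreal (\<alpha> j) * (\<integral>\<^sup>+x. f (serve k j x) \<partial>P)) + ennreal q * (\<integral>\<^sup>+x. f (incr_at i x) \<partial>P)
    = (ennreal q + (\<Sum>j=1..i. ennreal (\<alpha> j))) * (\<integral>\<^sup>+x. f x \<partial>P)"
    by (rule Suc.IH) (use Suc.prems in auto)
  have "(\<Sum>j=1..?j. ennreal (\<alpha> j) * (\<integral>\<^sup>+x. f (serve k j x) \<partial>P)) + ennreal q * (\<integral>\<^sup>+x. f (incr_at ?j x) \<partial>P)
      = (\<Sum>j=1..i. ennreal (\<alpha> j) * (\<integral>\<^sup>+x. f (serve k j x) \<partial>P))
        + (ennreal (\<alpha> ?j) * (\<integral>\<^sup>+x. f (serve k ?j x) \<partial>P) + ennreal q * (\<integral>\<^sup>+x. f (incr_at ?j x) \<partial>P))"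
    unfolding split by (simp only: add_ac)
  also have "\<dots> = ennreal (\<alpha> ?j) * (\<integral>\<^sup>+x. f x \<partial>P)
      + ((\<Sum>j=1..i. ennreal (\<alpha> j) * (\<integral>\<^sup>+x. f (serve k j x) \<partial>P)) + ennreal q * (\<integral>\<^sup>+x. f (incr_at i x) \<partial>P))"
    unfolding 3 by (simp only: add_ac)
  also have "\<dots> = (ennreal q + (\<Sum>j=1..?j. ennreal (\<alpha> j))) * (\<integral>\<^sup>+x. f x \<partial>P)"
    unfolding IH split by (simp add: distrib_right add_ac)
  finally show ?case .
qed

section \<open>The word law and finite sums over words\<close>

definition letter_law :: "nat \<Rightarrow> (nat \<Rightarrow> real) \<Rightarrow> nat pmf \<Rightarrow> bool" where
  "letter_law d \<alpha> L \<longleftrightarrow> set_pmf L \<subseteq> {1..d} \<and> (\<forall>j\<in>{1..d}. pmf L j = \<alpha> j)"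

lemma letter_law_exists:
  assumes "\<forall>i\<in>{1..d}. \<alpha> i \<ge> 0" "(\<Sum>i=1..d. \<alpha> i) = 1"
  obtains L where "letter_law d \<alpha> L"
proof -
  define f where "f j = (if j \<in> {1..d} then \<alpha> j else 0)" for j
  have "(\<integral>\<^sup>+j. ennreal (f j) \<partial>count_space UNIV) = (\<Sum>j\<in>{1..d}. ennreal (f j))"
    by (rule nn_integral_count_space') (auto simp: f_def)
  also have "\<dots> = ennreal (\<Sum>j=1..d. \<alpha> j)"
    using assms(1) by (subst sum_ennreal[symmetric]) (auto simp: f_def)
  finally have 1: "(\<integral>\<^sup>+j. ennreal (f j) \<partial>count_space UNIV) = 1" using assms(2) by simp
  have f0: "0 \<le> f j" for j using assms(1) by (simp add: f_def)
  have "pmf (embed_pmf f) j = f j" for j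
    by (rule pmf_embed_pmf[OF f0 1])
  then have "letter_law d \<alpha> (embed_pmf f)"
    by (auto simp: letter_law_def f_def set_pmf_iff split: if_splits)
  with that show ?thesis .
qed

lemma nn_integral_letter_law:
  assumes "letter_law d \<alpha> L"
  shows "(\<integral>\<^sup>+j. f j \<partial>L) = (\<Sum>j=1..d. ennreal (\<alpha> j) * f j)"
  using assms by (subst nn_integral_measure_pmf_support[of "{1..d}"])
    (auto simp: letter_law_def mult.commute intro!: sum.cong)

lemma sum_letter_law:
  assumes "letter_law d \<alpha> L"
  shows "(\<Sum>j=1..d. ennreal (\<alpha> j)) = 1"
  using nn_integral_letter_law[OF assms, of "\<lambda>_. 1"] by simp

lemma finite_words: "finite (words d n)"
proof -
  have "finite {w. set w \<subseteq> {1..d} \<and> length w = n}"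
    by (rule finite_lists_length_eq) simp
  then show ?thesis by (simp add: words_def conj_commute)
qed

lemma sum_words_Suc:
  "(\<Sum>w\<in>words d (Suc n). g w) = (\<Sum>w\<in>words d n. \<Sum>j=1..d. g (w @ [j]))"
proof -
  have "words d (Suc n) = (\<lambda>(w, j). w @ [j]) ` (words d n \<times> {1..d})"
  proof (intro equalityI subsetI)
    fix u assume u: "u \<in> words d (Suc n)"
    then have "u \<noteq> []" by (auto simp: words_def)
    then have "u = butlast u @ [last u]" "last u \<in> set u" by auto
    moreover have "butlast u \<in> words d n"
      using u by (auto simp: words_def dest: in_set_butlastD)
    ultimately show "u \<in> (\<lambda>(w, j). w @ [j]) ` (words d n \<times> {1..d})"
      using u by (intro image_eqI[of _ _ "(butlast u, last u)"]) (auto simp: words_def)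
  qed (auto simp: words_def)
  moreover have "inj_on (\<lambda>(w, j). w @ [j]) (words d n \<times> {1..d})"
    by (auto simp: inj_on_def)
  ultimately have "(\<Sum>w\<in>words d (Suc n). g w) = (\<Sum>(w, j)\<in>words d n \<times> {1..d}. g (w @ [j]))"
    by (simp add: sum.reindex case_prod_unfold)
  then show ?thesis
    using finite_words by (simp add: sum.cartesian_product)
qed

lemma word_prob_snoc: "word_prob \<alpha> (w @ [j]) = word_prob \<alpha> w * \<alpha> j"
proof -
  have "(\<Prod>i<length w. \<alpha> ((w @ [j]) ! i)) = (\<Prod>i<length w. \<alpha> (w ! i))"
    by (intro prod.cong) (auto simp: nth_append)
  then show ?thesis by (simp add: word_prob_def)
qed

lemma word_prob_nonneg:
  assumes "\<forall>i\<in>{1..d}. \<alpha> i \<ge> 0" "w \<in> words d n"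
  shows "0 \<le> word_prob \<alpha> w"
  unfolding word_prob_def
proof (intro prod_nonneg ballI)
  fix i assume "i \<in> {..<length w}"
  then have "w ! i \<in> set w" by simp
  then have "w ! i \<in> {1..d}" using assms(2) unfolding words_def by blast
  with assms(1) show "0 \<le> \<alpha> (w ! i)" by blast
qed

lemma nn_integral_word_pmf:
  assumes "letter_law d \<alpha> L" "\<forall>i\<in>{1..d}. \<alpha> i \<ge> 0"
  shows "(\<integral>\<^sup>+w. g w \<partial>word_pmf L n) = (\<Sum>w\<in>words d n. ennreal (word_prob \<alpha> w) * g w)"
proof (induction n arbitrary: g)
  case 0
  have "words d 0 = {[]}" by (auto simp: words_def)
  then show ?case by (simp add: word_prob_def)
next
  case (Suc n)
  have "(\<integral>\<^sup>+w. g w \<partial>word_pmf L (Suc n)) = (\<integral>\<^sup>+w. (\<Sum>j=1..d. ennreal (\<alpha> j) * g (w @ [j])) \<partial>word_pmf L n)"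
    by (simp add: nn_integral_letter_law[OF assms(1)])
  also have "\<dots> = (\<Sum>w\<in>words d n. ennreal (word_prob \<alpha> w) * (\<Sum>j=1..d. ennreal (\<alpha> j) * g (w @ [j])))"
    by (rule Suc.IH)
  also have "\<dots> = (\<Sum>w\<in>words d n. \<Sum>j=1..d. ennreal (word_prob \<alpha> (w @ [j])) * g (w @ [j]))"
    using assms(2) word_prob_nonneg[OF assms(2)]
    by (intro sum.cong refl) (auto simp: sum_distrib_left word_prob_snoc ennreal_mult mult.assoc intro!: sum.cong)
  finally show ?case by (simp only: sum_words_Suc)
qed

lemma set_word_pmf:
  assumes "letter_law d \<alpha> L" "w \<in> set_pmf (word_pmf L n)"
  shows "w \<in> words d n"
  using assms(2)
proof (induction n arbitrary: w)
  case (Suc n)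
  then show ?case using assms(1) by (fastforce simp: words_def letter_law_def)
qed (auto simp: words_def)

lemma max_0_square_le:
  fixes t a b c :: real
  assumes "t \<le> a + b + c"
  shows "(max 0 t)\<^sup>2 \<le> 3 * (a\<^sup>2 + b\<^sup>2 + c\<^sup>2)"
proof (cases "0 \<le> t")
  case True
  then have "(max 0 t)\<^sup>2 \<le> (a + b + c)\<^sup>2" using assms by (intro power_mono) auto
  also have "\<dots> \<le> 3 * (a\<^sup>2 + b\<^sup>2 + c\<^sup>2)"
    using sum_squares_bound[of a b] sum_squares_bound[of b c] sum_squares_bound[of a c]
    by (simp add: power2_eq_square algebra_simps)
  finally show ?thesis .
qed simp

text \<open>The number of letters at least \<open>k\<close> is binomial. It dominates row
  \<open>k\<close> and replaces the coupling when \<open>d * p * n\<close> is at most 4.\<close>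

lemma square_moments_count:
  assumes "letter_law d \<alpha> L" "\<forall>i\<in>{1..d}. \<alpha> i \<ge> 0" "s = (\<Sum>j | j \<in> {1..d} \<and> k \<le> j. \<alpha> j)" "s \<le> 1"
  shows "square_moments (word_pmf L n) (\<lambda>w. length (filter (\<lambda>j. k \<le> j) w)) (real n * s) (real n * (s - s\<^sup>2))"
proof (induction n)
  case 0
  then show ?case by (simp add: square_moments_def)
next
  case (Suc n)
  let ?N = "\<lambda>w. length (filter (\<lambda>j. k \<le> j) w)"
  let ?f = "\<lambda>j. if k \<le> j then 1 else 0 :: nat"
  have s0: "0 \<le> s" using assms(2) by (auto simp: assms(3) intro!: sum_nonneg)
  have s2: "s\<^sup>2 \<le> s" using s0 assms(4) by (simp add: power2_eq_square mult_left_le)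
  have *: "(\<integral>\<^sup>+j. of_nat (?f j) \<partial>L) = ennreal s"
  proof -
    have "(\<integral>\<^sup>+j. of_nat (?f j) \<partial>L) = (\<Sum>j=1..d. if k \<le> j then ennreal (\<alpha> j) else 0)"
      unfolding nn_integral_letter_law[OF assms(1)] by (intro sum.cong) auto
    also have "\<dots> = (\<Sum>j | j \<in> {1..d} \<and> k \<le> j. ennreal (\<alpha> j))"
      by (rule sum.inter_filter[symmetric]) simp
    also have "\<dots> = ennreal s"
      unfolding assms(3) using assms(2) by (intro sum_ennreal) auto
    finally show ?thesis .
  qed
  have "(?f j)\<^sup>2 = ?f j" for j by simp
  then have f: "square_moments L ?f s (s - s\<^sup>2)"
    using * s0 s2 by (simp add: square_moments_def del: of_nat_power)
  have eq: "map_pmf ?N (word_pmf L (Suc n)) = map_pmf (\<lambda>(w, j). ?N w + ?f j) (pair_pmf (word_pmf L n) L)"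
    by (simp add: map_bind_pmf pmf.map_comp o_def pair_pmf_def map_pmf_def bind_assoc_pmf bind_return_pmf if_distrib cong: if_cong)
  have "square_moments (map_pmf ?N (word_pmf L (Suc n))) (\<lambda>y. y) (real n * s + s) (real n * (s - s\<^sup>2) + (s - s\<^sup>2))"
    unfolding eq square_moments_map using square_moments_pair[OF Suc f] by (simp add: case_prod_unfold)
  then show ?case unfolding square_moments_map by (simp add: algebra_simps)
qed

section \<open>Second moments of the rows\<close>

text \<open>With source rate \<open>q = p + \<delta>\<close>, gap \<open>j\<close> has mean
  \<open>\<alpha> j / (q - \<alpha> j) \<le> p / \<delta>\<close> and variance at most
  \<open>(p / \<delta>) * (q / \<delta>)\<close>. The three summands are the variance of the source
  count, that of the gap sum, and the squared bias.\<close>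

lemma row_upper_second_moment:
  fixes \<alpha> :: "nat \<Rightarrow> real"
  assumes L: "letter_law d \<alpha> L" and nonneg: "\<forall>i\<in>{1..d}. \<alpha> i \<ge> 0"
    and le: "\<And>j. j \<in> {k..d} \<Longrightarrow> \<alpha> j \<le> p" and k: "1 \<le> k" "k \<le> d" and p: "0 \<le> p" and \<delta>: "0 < \<delta>"
    and q: "q = p + \<delta>"
  shows "(\<integral>\<^sup>+w. ennreal ((max 0 (real (shRSK w k) - real n * p))\<^sup>2) \<partial>word_pmf L n)
    \<le> ennreal (3 * (real n * (q * (1 + q)) + real d * p * q / \<delta>\<^sup>2 + (real n * \<delta> + real d * p / \<delta>)\<^sup>2))"
proof -
  define r where "r j = \<alpha> j / q" for j
  define S where "S = Pi_pmf {k..d} 0 (\<lambda>j. geometric_pmf (1 - r j))"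
  define m where "m j = \<alpha> j / (q - \<alpha> j)" for j
  have q0: "0 < q" using p \<delta> q by simp
  have \<alpha>: "0 \<le> \<alpha> j \<and> \<alpha> j \<le> p \<and> \<alpha> j < q" if "j \<in> {k..d}" for j
    using le[OF that] nonneg k that \<delta> q by auto
  have r: "0 \<le> r j" "r j < 1" if "j \<in> {k..d}" for j
    using \<alpha>[OF that] q0 by (auto simp: r_def)
  have m: "0 \<le> m j" "m j \<le> p / \<delta>" "m j = (1 - (1 - r j)) / (1 - r j)" if "j \<in> {k..d}" for j
  proof -
    note a = \<alpha>[OF that]
    show "0 \<le> m j" using a by (simp add: m_def)
    show "m j \<le> p / \<delta>" unfolding m_def using a \<delta> q p by (intro frac_le) auto
    show "m j = (1 - (1 - r j)) / (1 - r j)"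
      using a q0 by (simp add: m_def r_def field_simps)
  qed
  have mom: "square_moments S (\<lambda>x. \<Sum>i=k..d. x i) (\<Sum>i=k..d. m i) (\<Sum>i=k..d. m i * (1 + m i))"
    unfolding S_def
    by (intro square_moments_Pi_pmf square_moments_geometric) (use r m(3) in \<open>auto intro: r m(3)\<close>)
  have card: "real (card {k..d}) \<le> real d" using k by simp
  have M: "(\<Sum>i=k..d. m i) \<le> real d * p / \<delta>"
  proof -
    have "(\<Sum>i=k..d. m i) \<le> real (card {k..d}) * (p / \<delta>)" by (intro sum_bounded_above m(2))
    also have "\<dots> \<le> real d * (p / \<delta>)" using card p \<delta> by (intro mult_right_mono) auto
    finally show ?thesis by simp
  qed
  have V: "(\<Sum>i=k..d. m i * (1 + m i)) \<le> real d * p * q / \<delta>\<^sup>2"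
  proof -
    have "m i * (1 + m i) \<le> p / \<delta> * (1 + p / \<delta>)" if "i \<in> {k..d}" for i
      using m(1,2)[OF that] p \<delta> by (intro mult_mono) auto
    then have "(\<Sum>i=k..d. m i * (1 + m i)) \<le> real (card {k..d}) * (p / \<delta> * (1 + p / \<delta>))"
      by (intro sum_bounded_above)
    also have "\<dots> \<le> real d * (p / \<delta> * (1 + p / \<delta>))" using card p \<delta> by (intro mult_right_mono) auto
    also have "\<dots> = real d * p * q / \<delta>\<^sup>2" using \<delta> q by (simp add: field_simps power2_eq_square)
    finally show ?thesis .
  qed
  have "(\<integral>\<^sup>+w. ennreal ((max 0 (real (shRSK w k) - real n * p))\<^sup>2) \<partial>word_pmf L n)
    \<le> ennreal (3 * (real n * (q * (1 + q)) + (\<Sum>i=k..d. m i * (1 + m i)) + (real n * \<delta> + real d * p / \<delta>)\<^sup>2))"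
  proof (rule word_pmf_le_stationary[where S = S and T = "push k d" and Z = "dec_first (Suc d - k) k"
        and P = "\<lambda>w h x. set w \<subseteq> {1..d} \<and> incr_bound k d w h x" and s = "\<lambda>x. \<Sum>i=k..d. x i" and m = "\<Sum>i=k..d. m i"])
    fix f :: "(nat \<Rightarrow> nat) \<Rightarrow> ennreal"
    let ?g = "\<lambda>j. ennreal (\<alpha> j) * (\<integral>\<^sup>+x. f (push k d j x) \<partial>S)"
    have bal: "(\<Sum>j=k..d. ?g j) + ennreal q * (\<integral>\<^sup>+x. f (dec_first (Suc d - k) k x) \<partial>S)
        = (ennreal q + (\<Sum>j=k..d. ennreal (\<alpha> j))) * (\<integral>\<^sup>+x. f x \<partial>S)"
      unfolding S_def r_def by (rule push_balance_upto) (use \<alpha> k in auto)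
    have split: "(\<Sum>j=1..d. h j) = (\<Sum>j=1..<k. h j) + (\<Sum>j=k..d. h j)" for h :: "nat \<Rightarrow> ennreal"
      using k by (subst sum.union_disjoint[symmetric]) (auto intro!: sum.cong)
    \<comment> \<open>Letters below \<open>k\<close> leave the state unchanged; adding them
      completes the letter rates to total 1.\<close>
    have small: "(\<Sum>j=1..<k. ?g j) = (\<Sum>j=1..<k. ennreal (\<alpha> j)) * (\<integral>\<^sup>+x. f x \<partial>S)"
      unfolding sum_distrib_right by (intro sum.cong) (auto simp: push_def)
    have "(\<integral>\<^sup>+x. (\<integral>\<^sup>+j. f (push k d j x) \<partial>L) \<partial>S) = (\<Sum>j=1..d. ?g j)"
      by (simp add: nn_integral_letter_law[OF L] nn_integral_sum nn_integral_cmult)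
    then have "(\<integral>\<^sup>+x. (\<integral>\<^sup>+j. f (push k d j x) \<partial>L) \<partial>S) + ennreal q * (\<integral>\<^sup>+x. f (dec_first (Suc d - k) k x) \<partial>S)
      = (ennreal q + ((\<Sum>j=1..<k. ennreal (\<alpha> j)) + (\<Sum>j=k..d. ennreal (\<alpha> j)))) * (\<integral>\<^sup>+x. f x \<partial>S)"
      using bal small unfolding split[of ?g] by (simp add: distrib_right add_ac)
    also have "\<dots> = ennreal (1 + q) * (\<integral>\<^sup>+x. f x \<partial>S)"
      unfolding split[symmetric] sum_letter_law[OF L] using q0 by (simp add: add.commute)
    finally show "(\<integral>\<^sup>+x. (\<integral>\<^sup>+j. f (push k d j x) \<partial>L) \<partial>S) + ennreal q * (\<integral>\<^sup>+x. f (dec_first (Suc d - k) k x) \<partial>S)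
      = ennreal (1 + q) * (\<integral>\<^sup>+x. f x \<partial>S)" .
  next
    fix w h x
    assume P: "set w \<subseteq> {1..d} \<and> incr_bound k d w h x"
    have "real (shRSK w k) \<le> real h + real (\<Sum>i=k..d. x i)"
      using shRSK_le_incr_bound[of k d w h x] P k by (simp flip: of_nat_add del: of_nat_sum)
    then have "real (shRSK w k) - real n * p
        \<le> (real h - real n * q) + (real (\<Sum>i=k..d. x i) - (\<Sum>i=k..d. m i)) + (real n * \<delta> + real d * p / \<delta>)"
      using M q by (simp add: distrib_left)
    then show "(max 0 (real (shRSK w k) - real n * p))\<^sup>2
        \<le> 3 * ((real h - real n * q)\<^sup>2 + (real (\<Sum>i=k..d. x i) - (\<Sum>i=k..d. m i))\<^sup>2 + (real n * \<delta> + real d * p / \<delta>)\<^sup>2)"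
      by (rule max_0_square_le)
  qed (use q0 L mom incr_bound_init incr_bound_push incr_bound_zero in \<open>auto simp: letter_law_def\<close>)
  also have "\<dots> \<le> ennreal (3 * (real n * (q * (1 + q)) + real d * p * q / \<delta>\<^sup>2 + (real n * \<delta> + real d * p / \<delta>)\<^sup>2))"
    using V by (intro ennreal_leI) simp
  finally show ?thesis .
qed

text \<open>The source rate \<open>q = p - \<delta>\<close> must be positive, hence
  \<open>\<delta> < p\<close>. Here \<open>1 + q / \<delta> = p / \<delta>\<close>, so each queue
  has variance at most \<open>p\<^sup>2 / \<delta>\<^sup>2\<close>.\<close>

lemma row_lower_second_moment:
  fixes \<alpha> :: "nat \<Rightarrow> real"
  assumes L: "letter_law d \<alpha> L"
    and ge: "\<And>j. j \<in> {1..k} \<Longrightarrow> p \<le> \<alpha> j" and k: "1 \<le> k" "k \<le> d" and \<delta>: "0 < \<delta>" "\<delta> < p"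
    and q: "q = p - \<delta>"
  shows "(\<integral>\<^sup>+w. ennreal ((max 0 (real n * p - real (shRSK w k)))\<^sup>2) \<partial>word_pmf L n)
    \<le> ennreal (3 * (real n * (q * (1 + q)) + real d * p\<^sup>2 / \<delta>\<^sup>2 + (real n * \<delta> + real d * p / \<delta>)\<^sup>2))"
proof -
  define r where "r j = q / \<alpha> j" for j
  define S where "S = Pi_pmf {1..k} 0 (\<lambda>j. geometric_pmf (1 - r j))"
  define m where "m j = q / (\<alpha> j - q)" for j
  have q0: "0 < q" using \<delta> q by simp
  have \<alpha>: "p \<le> \<alpha> j \<and> q < \<alpha> j \<and> \<delta> \<le> \<alpha> j - q" if "j \<in> {1..k}" for j
    using ge[OF that] \<delta> q by auto
  have r: "0 \<le> r j" "r j < 1" if "j \<in> {1..k}" for j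
    using \<alpha>[OF that] q0 by (auto simp: r_def)
  have m: "0 \<le> m j" "m j \<le> q / \<delta>" "m j = (1 - (1 - r j)) / (1 - r j)" if "j \<in> {1..k}" for j
  proof -
    note a = \<alpha>[OF that]
    show "0 \<le> m j" using a q0 by (simp add: m_def)
    show "m j \<le> q / \<delta>" unfolding m_def using a \<delta> q q0 by (intro frac_le) auto
    show "m j = (1 - (1 - r j)) / (1 - r j)"
      using a q0 by (simp add: m_def r_def field_simps)
  qed
  have mom: "square_moments S (\<lambda>x. \<Sum>i=1..k. x i) (\<Sum>i=1..k. m i) (\<Sum>i=1..k. m i * (1 + m i))"
    unfolding S_def
    by (intro square_moments_Pi_pmf square_moments_geometric) (use r m(3) in \<open>auto intro: r m(3)\<close>)
  have card: "real (card {1..k}) \<le> real d" using k by simp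
  have M: "(\<Sum>i=1..k. m i) \<le> real d * p / \<delta>"
  proof -
    have "(\<Sum>i=1..k. m i) \<le> real (card {1..k}) * (q / \<delta>)" by (intro sum_bounded_above m(2))
    also have "\<dots> \<le> real d * (p / \<delta>)" using card q0 \<delta> q by (intro mult_mono divide_right_mono) auto
    finally show ?thesis by simp
  qed
  have V: "(\<Sum>i=1..k. m i * (1 + m i)) \<le> real d * p\<^sup>2 / \<delta>\<^sup>2"
  proof -
    have "m i * (1 + m i) \<le> p / \<delta> * (p / \<delta>)" if "i \<in> {1..k}" for i
    proof (intro mult_mono)
      show "m i \<le> p / \<delta>" using m(2)[OF that] q \<delta> by (meson diff_le_eq divide_right_mono le_add_same_cancel1 less_imp_le order_trans order_refl)
      have "1 + q / \<delta> = p / \<delta>" using \<delta> q by (simp add: field_simps)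
      then show "1 + m i \<le> p / \<delta>" using m(2)[OF that] by simp
    qed (use \<delta> m(1)[OF that] in auto)
    then have "(\<Sum>i=1..k. m i * (1 + m i)) \<le> real (card {1..k}) * (p / \<delta> * (p / \<delta>))"
      by (intro sum_bounded_above)
    also have "\<dots> \<le> real d * (p / \<delta> * (p / \<delta>))" using card \<delta> by (intro mult_right_mono) auto
    also have "\<dots> = real d * p\<^sup>2 / \<delta>\<^sup>2" by (simp add: power2_eq_square)
    finally show ?thesis .
  qed
  have "(\<integral>\<^sup>+w. ennreal ((max 0 (real n * p - real (shRSK w k)))\<^sup>2) \<partial>word_pmf L n)
    \<le> ennreal (3 * (real n * (q * (1 + q)) + (\<Sum>i=1..k. m i * (1 + m i)) + (real n * \<delta> + real d * p / \<delta>)\<^sup>2))"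
  proof (rule word_pmf_le_stationary[where S = S and T = "serve k" and Z = "incr_at k"
        and P = "\<lambda>w h x. set w \<subseteq> {1..d} \<and> decr_bound k w h x" and s = "\<lambda>x. \<Sum>i=1..k. x i" and m = "\<Sum>i=1..k. m i"])
    fix f :: "(nat \<Rightarrow> nat) \<Rightarrow> ennreal"
    let ?g = "\<lambda>j. ennreal (\<alpha> j) * (\<integral>\<^sup>+x. f (serve k j x) \<partial>S)"
    have bal: "(\<Sum>j=1..k. ?g j) + ennreal q * (\<integral>\<^sup>+x. f (incr_at k x) \<partial>S)
        = (ennreal q + (\<Sum>j=1..k. ennreal (\<alpha> j))) * (\<integral>\<^sup>+x. f x \<partial>S)"
      unfolding S_def r_def by (rule serve_balance_upto) (use \<alpha> q0 in auto)
    have split: "(\<Sum>j=1..d. h j) = (\<Sum>j=1..k. h j) + (\<Sum>j=Suc k..d. h j)" for h :: "nat \<Rightarrow> ennreal"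
      using k by (subst sum.union_disjoint[symmetric]) (auto intro!: sum.cong)
    have large: "(\<Sum>j=Suc k..d. ?g j) = (\<Sum>j=Suc k..d. ennreal (\<alpha> j)) * (\<integral>\<^sup>+x. f x \<partial>S)"
      unfolding sum_distrib_right by (intro sum.cong) (auto simp: serve_def)
    have "(\<integral>\<^sup>+x. (\<integral>\<^sup>+j. f (serve k j x) \<partial>L) \<partial>S) = (\<Sum>j=1..d. ?g j)"
      by (simp add: nn_integral_letter_law[OF L] nn_integral_sum nn_integral_cmult)
    then have "(\<integral>\<^sup>+x. (\<integral>\<^sup>+j. f (serve k j x) \<partial>L) \<partial>S) + ennreal q * (\<integral>\<^sup>+x. f (incr_at k x) \<partial>S)
      = (ennreal q + ((\<Sum>j=1..k. ennreal (\<alpha> j)) + (\<Sum>j=Suc k..d. ennreal (\<alpha> j)))) * (\<integral>\<^sup>+x. f x \<partial>S)"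
      using bal large unfolding split[of ?g] by (simp add: distrib_right add_ac)
    also have "\<dots> = ennreal (1 + q) * (\<integral>\<^sup>+x. f x \<partial>S)"
      unfolding split[symmetric] sum_letter_law[OF L] using q0 by (simp add: add.commute)
    finally show "(\<integral>\<^sup>+x. (\<integral>\<^sup>+j. f (serve k j x) \<partial>L) \<partial>S) + ennreal q * (\<integral>\<^sup>+x. f (incr_at k x) \<partial>S)
      = ennreal (1 + q) * (\<integral>\<^sup>+x. f x \<partial>S)" .
  next
    fix w h x
    assume P: "set w \<subseteq> {1..d} \<and> decr_bound k w h x"
    have "real h \<le> real (shRSK w k) + real (\<Sum>i=1..k. x i)"
      using shRSK_ge_decr_bound[of k w h x d] P k by (simp flip: of_nat_add del: of_nat_sum)
    then have "real n * p - real (shRSK w k)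
        \<le> (real n * q - real h) + (real (\<Sum>i=1..k. x i) - (\<Sum>i=1..k. m i)) + (real n * \<delta> + real d * p / \<delta>)"
      using M q by (simp add: right_diff_distrib)
    then show "(max 0 (real n * p - real (shRSK w k)))\<^sup>2
        \<le> 3 * ((real h - real n * q)\<^sup>2 + (real (\<Sum>i=1..k. x i) - (\<Sum>i=1..k. m i))\<^sup>2 + (real n * \<delta> + real d * p / \<delta>)\<^sup>2)"
      unfolding power2_commute[of "real h" "real n * q"] by (rule max_0_square_le)
  qed (use q0 L mom decr_bound_init decr_bound_serve decr_bound_zero in \<open>auto simp: letter_law_def\<close>)
  also have "\<dots> \<le> ennreal (3 * (real n * (q * (1 + q)) + real d * p\<^sup>2 / \<delta>\<^sup>2 + (real n * \<delta> + real d * p / \<delta>)\<^sup>2))"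
    using V by (intro ennreal_leI) simp
  finally show ?thesis .
qed

section \<open>Choice of the shift and the degenerate regimes\<close>

lemma shRSK_le_count:
  assumes "set w \<subseteq> {1..d}" "1 \<le> k"
  shows "shRSK w k \<le> length (filter (\<lambda>j. k \<le> j) w)"
proof -
  have "0 \<notin> set w" using assms(1) by auto
  then obtain C where C: "weakly_incr_subseq w C" "\<And>t. t \<in> C \<Longrightarrow> k \<le> w ! t" "shRSK w k \<le> card C"
    using shRSK_le_incr_subseq[OF _ assms(2)] by metis
  have "card C \<le> card {t. t < length w \<and> k \<le> w ! t}"
    using C(1,2) by (intro card_mono) (auto simp: weakly_incr_subseq_def)
  with C(3) show ?thesis by (simp add: length_filter_conv_card)
qed

text \<open>For \<open>S > 4\<close> one has \<open>sqrt S \<le> S / 2\<close>, and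
  \<open>d \<ge> 2\<close> gives \<open>n * p \<le> S / 2\<close>, so \<open>n * q \<le> S\<close>.
  Moreover \<open>S \<le> n^2\<close> gives \<open>\<delta> \<le> 1\<close>, hence
  \<open>1 + q \<le> 3\<close>; the total is \<open>3 * (3 + 1 + 4) * S\<close>. For
  \<open>S \<le> 4\<close> the binomial bound costs at most
  \<open>S^2 + S \<le> 5 * S\<close>.\<close>

lemma row_upper_deviation:
  fixes \<alpha> :: "nat \<Rightarrow> real"
  assumes L: "letter_law d \<alpha> L" and nonneg: "\<forall>i\<in>{1..d}. \<alpha> i \<ge> 0" and sum1: "(\<Sum>i=1..d. \<alpha> i) = 1"
    and le: "\<And>j. j \<in> {k..d} \<Longrightarrow> \<alpha> j \<le> p" and k: "1 \<le> k" "k \<le> d" and p: "0 < p" "p \<le> 1"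
    and n: "1 \<le> n" and d: "2 \<le> d" and S: "S = real d * p * real n" "S \<le> (real n)\<^sup>2"
  shows "(\<integral>\<^sup>+w. ennreal ((max 0 (real (shRSK w k) - real n * p))\<^sup>2) \<partial>word_pmf L n) \<le> ennreal (24 * S)"
proof (cases "S \<le> 4")
  case True
  define s where "s = (\<Sum>j | j \<in> {1..d} \<and> k \<le> j. \<alpha> j)"
  have s0: "0 \<le> s" unfolding s_def using nonneg by (intro sum_nonneg) auto
  have s1: "s \<le> 1" unfolding s_def sum1[symmetric] using nonneg by (intro sum_mono2) auto
  have "s \<le> real (card {j. j \<in> {1..d} \<and> k \<le> j}) * p"
    unfolding s_def by (intro sum_bounded_above) (use le in auto)
  also have "\<dots> \<le> real (card {1..d}) * p"
    using p by (intro mult_right_mono of_nat_mono card_mono) auto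
  finally have "real n * s \<le> real n * (real d * p)" by (intro mult_left_mono) simp_all
  then have nsS: "real n * s \<le> S" by (simp add: S(1) mult_ac)
  have "(\<integral>\<^sup>+w. ennreal ((max 0 (real (shRSK w k) - real n * p))\<^sup>2) \<partial>word_pmf L n)
      \<le> (\<integral>\<^sup>+w. of_nat ((length (filter (\<lambda>j. k \<le> j) w))\<^sup>2) \<partial>word_pmf L n)"
  proof (intro nn_integral_mono_AE AE_pmfI)
    fix w assume "w \<in> set_pmf (word_pmf L n)"
    then have "set w \<subseteq> {1..d}" using set_word_pmf[OF L] by (auto simp: words_def)
    then have "shRSK w k \<le> length (filter (\<lambda>j. k \<le> j) w)" using k by (intro shRSK_le_count)
    then have "max 0 (real (shRSK w k) - real n * p) \<le> real (length (filter (\<lambda>j. k \<le> j) w))"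
      using mult_nonneg_nonneg[of "real n" p] p by linarith
    then have "(max 0 (real (shRSK w k) - real n * p))\<^sup>2 \<le> (real (length (filter (\<lambda>j. k \<le> j) w)))\<^sup>2"
      by (intro power_mono) auto
    then show "ennreal ((max 0 (real (shRSK w k) - real n * p))\<^sup>2) \<le> of_nat ((length (filter (\<lambda>j. k \<le> j) w))\<^sup>2)"
      unfolding ennreal_of_nat_eq_real_of_nat of_nat_power by (rule ennreal_leI)
  qed
  also have "\<dots> = ennreal ((real n * s)\<^sup>2 + real n * (s - s\<^sup>2))"
    using square_moments_count[OF L nonneg s_def s1, of n] unfolding square_moments_def by blast
  also have "\<dots> \<le> ennreal (24 * S)"
  proof (rule ennreal_leI)
    have "(real n * s)\<^sup>2 \<le> S * S"
      unfolding power2_eq_square using nsS s0 by (intro mult_mono) (auto simp: p S(1) less_imp_le)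
    also have "\<dots> \<le> 4 * S" using True p by (intro mult_right_mono) (simp_all add: S(1))
    finally have "(real n * s)\<^sup>2 \<le> 4 * S" .
    moreover have "real n * (s - s\<^sup>2) \<le> real n * s" by (intro mult_left_mono) auto
    moreover have "0 \<le> S" using p by (simp add: S(1))
    ultimately show "(real n * s)\<^sup>2 + real n * (s - s\<^sup>2) \<le> 24 * S" using nsS by linarith
  qed
  finally show ?thesis .
next
  case False
  define \<delta> where "\<delta> = sqrt S / real n"
  define q where "q = p + \<delta>"
  have S0: "0 < S" using False by simp
  then have sq4: "(sqrt S + sqrt S)\<^sup>2 = 4 * S" by (simp add: power2_eq_square algebra_simps)
  have n0: "0 < real n" using n by simp
  have \<delta>: "0 < \<delta>" using S0 n0 by (simp add: \<delta>_def)
  have "sqrt S \<le> real n" using S(2) n0 by (simp add: real_le_lsqrt)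
  then have \<delta>1: "\<delta> \<le> 1" using n0 by (simp add: \<delta>_def)
  have "sqrt S * 2 \<le> sqrt S * sqrt S"
    using False real_sqrt_le_mono[of 4 S] S0 by (intro mult_left_mono) auto
  then have sq: "sqrt S \<le> S / 2" using S0 by simp
  have n\<delta>: "real n * \<delta> = sqrt S" using n0 by (simp add: \<delta>_def)
  have \<delta>2: "\<delta>\<^sup>2 = real d * p / real n"
    using S0 n0 by (simp add: \<delta>_def power_divide S(1) power2_eq_square)
  have dp: "real d * p / \<delta> = sqrt S"
  proof -
    have "real d * p = sqrt S * \<delta>" using \<delta>2 n\<delta> n0 by (simp add: power2_eq_square field_simps)
    then show ?thesis using \<delta> by simp
  qed
  have dpq: "real d * p * q / \<delta>\<^sup>2 = real n * q"
    unfolding \<delta>2 using p d n0 by simp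
  have "real n * p * 2 \<le> S" unfolding S(1) using d p n0 by (simp add: mult_ac)
  then have nq: "real n * q \<le> S" using sq n\<delta> by (simp add: q_def distrib_left)
  have nq0: "0 \<le> real n * q" using p \<delta> by (simp add: q_def)
  have arith: "3 * (a + b + 4 * c) \<le> 24 * c" if "a \<le> c * 3" "b \<le> c" for a b c :: real
    using add_mono[OF mult_left_mono[OF that(1), of 3] mult_left_mono[OF that(2), of 3]]
    by (simp add: distrib_left)
  have "real n * q * (1 + q) \<le> S * 3"
    using nq p \<delta> \<delta>1 S0 by (intro mult_mono) (auto simp: q_def)
  then have *: "3 * (real n * (q * (1 + q)) + real d * p * q / \<delta>\<^sup>2 + (real n * \<delta> + real d * p / \<delta>)\<^sup>2) \<le> 24 * S"
    unfolding dpq n\<delta> dp sq4 mult.assoc[of "real n" q] using nq by (intro arith)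
  have "(\<integral>\<^sup>+w. ennreal ((max 0 (real (shRSK w k) - real n * p))\<^sup>2) \<partial>word_pmf L n)
    \<le> ennreal (3 * (real n * (q * (1 + q)) + real d * p * q / \<delta>\<^sup>2 + (real n * \<delta> + real d * p / \<delta>)\<^sup>2))"
    by (rule row_upper_second_moment[OF L nonneg le k]) (use p \<delta> q_def in auto)
  also have "\<dots> \<le> ennreal (24 * S)" using * by (rule ennreal_leI)
  finally show ?thesis .
qed

text \<open>The optimal \<open>\<delta>\<close> is below \<open>p\<close> exactly when
  \<open>n * p > d\<close>. Otherwise the deviation is at most \<open>n * p\<close>, whose square is
  at most \<open>d * n * p = S\<close>.\<close>

lemma row_lower_deviation:
  fixes \<alpha> :: "nat \<Rightarrow> real"
  assumes L: "letter_law d \<alpha> L"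
    and ge: "\<And>j. j \<in> {1..k} \<Longrightarrow> p \<le> \<alpha> j" and k: "1 \<le> k" "k \<le> d" and p: "0 < p" "p \<le> 1"
    and n: "1 \<le> n" and S: "S = real d * p * real n"
  shows "(\<integral>\<^sup>+w. ennreal ((max 0 (real n * p - real (shRSK w k)))\<^sup>2) \<partial>word_pmf L n)
    \<le> ennreal (9 * (real n * p) + 12 * S)"
proof (cases "real n * p \<le> real d")
  case True
  have "(real n * p)\<^sup>2 \<le> S"
    unfolding power2_eq_square S using True p n by (simp add: mult_ac)
  moreover have "S \<le> 9 * (real n * p) + 12 * S"
    using p by (simp add: S)
  ultimately have *: "(real n * p)\<^sup>2 \<le> 9 * (real n * p) + 12 * S" by linarith
  have "(\<integral>\<^sup>+w. ennreal ((max 0 (real n * p - real (shRSK w k)))\<^sup>2) \<partial>word_pmf L n)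
      \<le> (\<integral>\<^sup>+w. ennreal (9 * (real n * p) + 12 * S) \<partial>word_pmf L n)"
  proof (intro nn_integral_mono ennreal_leI)
    fix w
    have "(max 0 (real n * p - real (shRSK w k)))\<^sup>2 \<le> (real n * p)\<^sup>2"
      using p by (intro power_mono) auto
    with * show "(max 0 (real n * p - real (shRSK w k)))\<^sup>2 \<le> 9 * (real n * p) + 12 * S" by linarith
  qed
  then show ?thesis by simp
next
  case False
  define \<delta> where "\<delta> = sqrt S / real n"
  define q where "q = p - \<delta>"
  have n0: "0 < real n" using n by simp
  have d0: "0 < real d" using k by simp
  have S0: "0 < S" using n0 d0 p by (simp add: S)
  then have sq4: "(sqrt S + sqrt S)\<^sup>2 = 4 * S" by (simp add: power2_eq_square algebra_simps)
  have \<delta>: "0 < \<delta>" using S0 n0 by (simp add: \<delta>_def)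
  have n\<delta>: "real n * \<delta> = sqrt S" using n0 by (simp add: \<delta>_def)
  have \<delta>2: "\<delta>\<^sup>2 = real d * p / real n"
    using S0 n0 by (simp add: \<delta>_def power_divide S power2_eq_square)
  have "\<delta>\<^sup>2 < p\<^sup>2"
    unfolding \<delta>2 using False p n0 by (simp add: power2_eq_square field_simps)
  then have \<delta>p: "\<delta> < p" using p by (simp add: power2_less_imp_less)
  have dp: "real d * p / \<delta> = sqrt S"
  proof -
    have "real d * p = sqrt S * \<delta>" using \<delta>2 n\<delta> n0 by (simp add: power2_eq_square field_simps)
    then show ?thesis using \<delta> by simp
  qed
  have dp2: "real d * p\<^sup>2 / \<delta>\<^sup>2 = real n * p"
    unfolding \<delta>2 using p d0 n0 by (simp add: power2_eq_square)
  have arith: "3 * (a + b + 4 * c) \<le> 9 * b + 12 * c" if "a \<le> b * 2" for a b c :: real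
    using mult_left_mono[OF that, of 3] by (simp add: distrib_left)
  have "real n * q * (1 + q) \<le> (real n * p) * 2"
    using p \<delta> \<delta>p n0 by (intro mult_mono) (auto simp: q_def)
  then have *: "3 * (real n * (q * (1 + q)) + real d * p\<^sup>2 / \<delta>\<^sup>2 + (real n * \<delta> + real d * p / \<delta>)\<^sup>2)
      \<le> 9 * (real n * p) + 12 * S"
    unfolding dp2 n\<delta> dp sq4 mult.assoc[of "real n" q] using arith by blast
  have "(\<integral>\<^sup>+w. ennreal ((max 0 (real n * p - real (shRSK w k)))\<^sup>2) \<partial>word_pmf L n)
    \<le> ennreal (3 * (real n * (q * (1 + q)) + real d * p\<^sup>2 / \<delta>\<^sup>2 + (real n * \<delta> + real d * p / \<delta>)\<^sup>2))"
    by (rule row_lower_second_moment[OF L ge k]) (use \<delta> \<delta>p q_def in auto)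
  also have "\<dots> \<le> ennreal (9 * (real n * p) + 12 * S)" using * by (rule ennreal_leI)
  finally show ?thesis .
qed

lemma row_second_moment:
  fixes \<alpha> :: "nat \<Rightarrow> real"
  assumes nonneg: "\<forall>i\<in>{1..d}. \<alpha> i \<ge> 0" and sum1: "(\<Sum>i=1..d. \<alpha> i) = 1"
    and sorted: "\<forall>i\<in>{1..d}. \<forall>j\<in>{1..d}. i \<le> j \<longrightarrow> \<alpha> j \<le> \<alpha> i"
    and k: "1 \<le> k" "k \<le> d" and pos: "0 < \<alpha> k" and n: "1 \<le> n"
  shows "(\<Sum>w\<in>words d n. word_prob \<alpha> w * (real (shRSK w k) - real n * \<alpha> k)\<^sup>2) \<le> 46 * (real d * \<alpha> k * real n)"
proof -
  obtain L where L: "letter_law d \<alpha> L" using letter_law_exists[OF nonneg sum1] .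
  define p where "p = \<alpha> k"
  define S where "S = real d * p * real n"
  have p: "0 < p" "p \<le> 1"
  proof -
    show "0 < p" using pos by (simp add: p_def)
    have "\<alpha> k \<le> (\<Sum>i=1..d. \<alpha> i)" using nonneg k by (intro member_le_sum) auto
    then show "p \<le> 1" unfolding p_def sum1 .
  qed
  have n0: "0 < real n" using n by simp
  have S0: "0 < S" using p n0 k by (simp add: S_def)
  have le: "\<alpha> j \<le> p" if "j \<in> {k..d}" for j using sorted k that by (auto simp: p_def)
  have ge: "p \<le> \<alpha> j" if "j \<in> {1..k}" for j using sorted k that by (auto simp: p_def)
  have len: "shRSK w k \<le> n" if "w \<in> set_pmf (word_pmf L n)" for w
  proof -
    have w: "set w \<subseteq> {1..d}" "length w = n" using set_word_pmf[OF L that] by (auto simp: words_def)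
    have "shRSK w k \<le> length (filter (\<lambda>j. k \<le> j) w)" by (rule shRSK_le_count[OF w(1) k(1)])
    also have "\<dots> \<le> n" using w(2) length_filter_le by metis
    finally show ?thesis .
  qed
  have "(\<integral>\<^sup>+w. ennreal ((real (shRSK w k) - real n * p)\<^sup>2) \<partial>word_pmf L n) \<le> ennreal (46 * S)"
  proof (cases "S \<le> (real n)\<^sup>2")
    case False
    have "(\<integral>\<^sup>+w. ennreal ((real (shRSK w k) - real n * p)\<^sup>2) \<partial>word_pmf L n) \<le> (\<integral>\<^sup>+w. ennreal (46 * S) \<partial>word_pmf L n)"
    proof (intro nn_integral_mono_AE AE_pmfI ennreal_leI)
      fix w assume "w \<in> set_pmf (word_pmf L n)"
      then have 1: "real (shRSK w k) \<le> real n" using len by simp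
      have 2: "0 \<le> real n * p" "real n * p \<le> real n" using p by (auto simp: mult_left_le)
      have "\<bar>real (shRSK w k) - real n * p\<bar> \<le> real n"
        using 1 2 of_nat_0_le_iff[of "shRSK w k", where ?'a = real] by linarith
      then have "(real (shRSK w k) - real n * p)\<^sup>2 \<le> (real n)\<^sup>2"
        by (metis abs_ge_zero power2_abs power_mono)
      with False S0 show "(real (shRSK w k) - real n * p)\<^sup>2 \<le> 46 * S" by linarith
    qed
    then show ?thesis by simp
  next
    case True
    have low: "(\<integral>\<^sup>+w. ennreal ((max 0 (real n * p - real (shRSK w k)))\<^sup>2) \<partial>word_pmf L n)
        \<le> ennreal (9 * (real n * p) + 12 * S)"
      by (rule row_lower_deviation[OF L ge k p n S_def])
    \<comment> \<open>For \<open>d \<ge> 2\<close>, \<open>n * p \<le> S / 2\<close> leaves a total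
      of at most \<open>40.5 * S\<close>. For \<open>d = 1\<close> that inequality fails, but then
      \<open>p = 1\<close> and no row exceeds \<open>n\<close>, so the upper part vanishes.\<close>
    have "(\<integral>\<^sup>+w. ennreal ((max 0 (real (shRSK w k) - real n * p))\<^sup>2) \<partial>word_pmf L n) \<le> ennreal (24 * S)
        \<and> 24 * S + (9 * (real n * p) + 12 * S) \<le> 46 * S
      \<or> (\<integral>\<^sup>+w. ennreal ((max 0 (real (shRSK w k) - real n * p))\<^sup>2) \<partial>word_pmf L n) = ennreal 0 \<and> real n * p \<le> S"
    proof (cases "2 \<le> d")
      case True
      then have "real n * p * 2 \<le> S" using p n0 by (simp add: S_def mult_ac)
      then have "24 * S + (9 * (real n * p) + 12 * S) \<le> 46 * S" using S0 by linarith
      then show ?thesis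
        using row_upper_deviation[OF L nonneg sum1 le k p n True S_def \<open>S \<le> (real n)\<^sup>2\<close>] by simp
    next
      case False
      then have d: "d = 1" "k = 1" using k by auto
      then have p1: "p = 1" using sum1 by (simp add: p_def)
      have "(\<integral>\<^sup>+w. ennreal ((max 0 (real (shRSK w k) - real n * p))\<^sup>2) \<partial>word_pmf L n) = (\<integral>\<^sup>+w. ennreal 0 \<partial>word_pmf L n)"
        using len by (intro nn_integral_cong_AE AE_pmfI) (simp add: p1)
      then show ?thesis using p1 d by (simp add: S_def)
    qed
    then obtain u where u: "(\<integral>\<^sup>+w. ennreal ((max 0 (real (shRSK w k) - real n * p))\<^sup>2) \<partial>word_pmf L n) \<le> ennreal u"
      "0 \<le> u" "u + (9 * (real n * p) + 12 * S) \<le> 46 * S"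
      using S0 by (elim disjE conjE) (auto intro: that[of "24 * S"] that[of 0])
    have "(\<integral>\<^sup>+w. ennreal ((real (shRSK w k) - real n * p)\<^sup>2) \<partial>word_pmf L n)
        = (\<integral>\<^sup>+w. ennreal ((max 0 (real (shRSK w k) - real n * p))\<^sup>2)
            + ennreal ((max 0 (real n * p - real (shRSK w k)))\<^sup>2) \<partial>word_pmf L n)"
    proof (rule nn_integral_cong)
      fix w
      have "(real (shRSK w k) - real n * p)\<^sup>2
          = (max 0 (real (shRSK w k) - real n * p))\<^sup>2 + (max 0 (real n * p - real (shRSK w k)))\<^sup>2"
        by (auto simp: max_def power2_commute)
      then show "ennreal ((real (shRSK w k) - real n * p)\<^sup>2)
          = ennreal ((max 0 (real (shRSK w k) - real n * p))\<^sup>2) + ennreal ((max 0 (real n * p - real (shRSK w k)))\<^sup>2)"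
        by (simp add: ennreal_plus)
    qed
    also have "\<dots> = (\<integral>\<^sup>+w. ennreal ((max 0 (real (shRSK w k) - real n * p))\<^sup>2) \<partial>word_pmf L n)
            + (\<integral>\<^sup>+w. ennreal ((max 0 (real n * p - real (shRSK w k)))\<^sup>2) \<partial>word_pmf L n)"
      by (rule nn_integral_add) auto
    also have "\<dots> \<le> ennreal u + ennreal (9 * (real n * p) + 12 * S)"
      by (rule add_mono[OF u(1) low])
    also have "\<dots> = ennreal (u + (9 * (real n * p) + 12 * S))"
      using u(2) p S0 by (intro ennreal_plus[symmetric]) auto
    also have "\<dots> \<le> ennreal (46 * S)"
      using u(3) by (rule ennreal_leI)
    finally show ?thesis .
  qed
  also have "(\<integral>\<^sup>+w. ennreal ((real (shRSK w k) - real n * p)\<^sup>2) \<partial>word_pmf L n)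
      = ennreal (\<Sum>w\<in>words d n. word_prob \<alpha> w * (real (shRSK w k) - real n * p)\<^sup>2)"
    using word_prob_nonneg[OF nonneg]
    by (simp add: nn_integral_word_pmf[OF L nonneg] sum_ennreal flip: ennreal_mult)
  finally show ?thesis
    using S0 by (simp add: ennreal_le_iff p_def S_def)
qed

text \<open>Multiply by \<open>b\<close> and enlarge the factor \<open>sqrt b\<close> to
  \<open>sqrt a + sqrt b\<close>; the product becomes \<open>a - b\<close>.\<close>

lemma sqrt_diff_square_le:
  fixes a b :: real
  assumes "0 \<le> a" "0 < b"
  shows "(sqrt a - sqrt b)\<^sup>2 \<le> b * (a / b - 1)\<^sup>2"
proof -
  have "b * (sqrt a - sqrt b)\<^sup>2 = (sqrt b * (sqrt a - sqrt b))\<^sup>2"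
    using assms by (simp add: power_mult_distrib)
  also have "\<dots> \<le> ((sqrt a + sqrt b) * (sqrt a - sqrt b))\<^sup>2"
    using assms unfolding power_mult_distrib by (intro mult_right_mono power_mono) auto
  also have "\<dots> = (a - b)\<^sup>2" using assms by (simp add: algebra_simps)
  also have "\<dots> = b * (b * (a / b - 1)\<^sup>2)" using assms by (simp add: power2_eq_square field_simps)
  finally show ?thesis using assms by simp
qed

theorem mainTheorem5:
  fixes d k n :: nat and \<alpha> :: "nat \<Rightarrow> real"
  assumes nonneg: "\<forall>i\<in>{1..d}. \<alpha> i \<ge> 0"
    and sum1: "(\<Sum>i=1..d. \<alpha> i) = 1"
    and sorted: "\<forall>i\<in>{1..d}. \<forall>j\<in>{1..d}. i \<le> j \<longrightarrow> \<alpha> j \<le> \<alpha> i"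
    and k_range: "1 \<le> k" "k \<le> d"
    and pos: "\<forall>i\<in>{1..k}. \<alpha> i > 0"
    and n_pos: "n \<ge> 1"
  shows "SW_expect d n \<alpha> (\<lambda>lam. \<Sum>i=1..k. \<alpha> i * ((real (lam i) / real n) / \<alpha> i - 1)\<^sup>2)
           \<le> 46 * real k * real d / real n
       \<and> SW_expect d n \<alpha> (\<lambda>lam. \<Sum>i=1..k. (sqrt (real (lam i) / real n) - sqrt (\<alpha> i))\<^sup>2)
           \<le> 46 * real k * real d / real n"
proof
  have n0: "0 < real n" using n_pos by simp
  let ?chi = "\<lambda>lam. \<Sum>i=1..k. \<alpha> i * ((real (lam i) / real n) / \<alpha> i - 1)\<^sup>2"
  let ?hel = "\<lambda>lam. \<Sum>i=1..k. (sqrt (real (lam i) / real n) - sqrt (\<alpha> i))\<^sup>2"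
  have "SW_expect d n \<alpha> ?chi
      = (\<Sum>i=1..k. \<Sum>w\<in>words d n. word_prob \<alpha> w * (\<alpha> i * ((real (shRSK w i) / real n) / \<alpha> i - 1)\<^sup>2))"
    unfolding SW_expect_def sum_distrib_left by (rule sum.swap)
  also have "\<dots> \<le> (\<Sum>i=1..k. 46 * real d / real n)"
  proof (rule sum_mono)
    fix i assume i: "i \<in> {1..k}"
    have a: "0 < \<alpha> i" using pos i by blast
    have eq: "\<alpha> i * ((x / real n) / \<alpha> i - 1)\<^sup>2 = (x - real n * \<alpha> i)\<^sup>2 / ((real n)\<^sup>2 * \<alpha> i)" for x
      using a n0 by (simp add: power2_eq_square field_simps)
    have "(\<Sum>w\<in>words d n. word_prob \<alpha> w * (\<alpha> i * ((real (shRSK w i) / real n) / \<alpha> i - 1)\<^sup>2))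
        = (\<Sum>w\<in>words d n. word_prob \<alpha> w * (real (shRSK w i) - real n * \<alpha> i)\<^sup>2) / ((real n)\<^sup>2 * \<alpha> i)"
      unfolding eq by (simp add: sum_divide_distrib)
    also have "\<dots> \<le> 46 * (real d * \<alpha> i * real n) / ((real n)\<^sup>2 * \<alpha> i)"
      using i k_range a by (intro divide_right_mono row_second_moment nonneg sum1 sorted n_pos) auto
    also have "\<dots> = 46 * real d / real n"
      using a n0 by (simp add: power2_eq_square)
    finally show "(\<Sum>w\<in>words d n. word_prob \<alpha> w * (\<alpha> i * ((real (shRSK w i) / real n) / \<alpha> i - 1)\<^sup>2))
        \<le> 46 * real d / real n" .
  qed
  also have "\<dots> = 46 * real k * real d / real n" by simp
  finally show chi: "SW_expect d n \<alpha> ?chi \<le> 46 * real k * real d / real n" .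
  have "SW_expect d n \<alpha> ?hel \<le> SW_expect d n \<alpha> ?chi"
    unfolding SW_expect_def
    by (intro sum_mono mult_left_mono sqrt_diff_square_le word_prob_nonneg[OF nonneg]) (use pos in auto)
  with chi show "SW_expect d n \<alpha> ?hel \<le> 46 * real k * real d / real n" by linarith
qed

end
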